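(* Let $k\ge 2$ be an integer and let $\mathcal E(n,k)$ denote the expected palindromic richness of a random $k$-ary word of length $n$ (the word chosen uniformly at random among all $k^n$ words of length $n$ over a fixed $k$-letter alphabet). Then: (1) $\mathcal E(n,k)=\Theta(\sqrt{n})$ as $n\to\infty$ with $k$ fixed; (2) the ratio $\mathcal E(n,k)/\sqrt{n}$ has no limit as $n\to\infty$ with $k$ fixed; (3) the function $\underline{C}(k)=\liminf_{n\to\infty}\mathcal E(n,k)/\sqrt{n}$ is $\Theta(1)$ as $k\to\infty$; (4) the function $\overline{C}(k)=\limsup_{n\to\infty}\mathcal E(n,k)/\sqrt{n}$ is $\Theta(\sqrt{k})$ as $k\to\infty$.
   Context: A word $a_1\cdots a_n$ is a palindrome if $a_1\cdots a_n=a_n\cdots a_1$; the empty word is not counted as a palindrome. The palindromic richness of a word $w$ is the number of distinct non-empty palindromes that occur as factors (contiguous subwords) of $w$. *)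

theory Defs
  imports
    "HOL-Probability.Probability"
    "HOL-Library.Sublist"
    "HOL-Library.Landau_Symbols"
begin

text \<open>Words are lists; the factors (contiguous subwords) of a word are its sublists in the
  sense of \<^const>\<open>sublist\<close>.\<close>

definition palindrome :: "'a list \<Rightarrow> bool" where
  "palindrome w \<longleftrightarrow> w \<noteq> [] \<and> w = rev w"

definition palindromic_richness :: "'a list \<Rightarrow> nat" where
  "palindromic_richness w = card {p. palindrome p \<and> sublist p w}"

text \<open>The \<open>k\<close>-letter alphabet is fixed to be \<open>{0, \<dots>, k - 1}\<close>.\<close>

definition words :: "nat \<Rightarrow> nat \<Rightarrow> nat list set" where
  "words n k = {w. length w = n \<and> set w \<subseteq> {..<k}}"

definition expected_richness :: "nat \<Rightarrow> nat \<Rightarrow> real" where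
  "expected_richness n k =
     measure_pmf.expectation (pmf_of_set (words n k)) (\<lambda>w. real (palindromic_richness w))"

definition lower_const :: "nat \<Rightarrow> ereal" where
  "lower_const k = liminf (\<lambda>n. ereal (expected_richness n k / sqrt (real n)))"

definition upper_const :: "nat \<Rightarrow> ereal" where
  "upper_const k = limsup (\<lambda>n. ereal (expected_richness n k / sqrt (real n)))"

end

theory Submission
  imports Defs "HOL-Complex_Analysis.Conformal_Mappings" "HOL-Real_Asymp.Real_Asymp"
begin

text \<open>For a word \<open>p\<close> of length \<open>m\<close>, the first occurrence of \<open>p\<close> in a random word satisfies a renewal
  equation: the probability \<open>k^-m\<close> that \<open>p\<close> ends at a given place is the convolution of the law of the
  first occurrence with the probabilities that \<open>p\<close> returns after \<open>d\<close> more letters. Summing it gives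
  \<open>(n + 1 - m) / (2 k^m + n) \<le> P(p occurs) \<le> min 1 (n / k^m)\<close>. There are \<open>k^\<lceil>m/2\<rceil>\<close> palindromes of length \<open>m\<close>,
  and summing over \<open>m\<close> yields all the bounds; the extreme orders of \<open>E(n,k)/\<surd>n\<close> are attained along
  \<open>n = k^(2j)\<close> and \<open>n = k^(2j+1)\<close>.

  For the divergence, the renewal equation is turned into generating functions. On average over
  palindromes the self-overlaps contribute little, and
  \<open>s \<Sum>n. E(n,k) (1-s)^n = \<Sum>m\<ge>1. k^\<lceil>m/2\<rceil> / (1 + s k^m) + O(s^(-1/4))\<close> as \<open>s \<longlongrightarrow> 0\<close>. If
  \<open>E(n,k)/\<surd>n\<close> converged, the right-hand side would be asymptotic to \<open>c/\<surd>s\<close>; replacing \<open>s\<close> by \<open>s k^(-2M)\<close>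
  and letting \<open>M \<longlongrightarrow> \<infinity>\<close> would give \<open>\<Sum>m\<in>\<int>. k^\<lceil>m/2\<rceil> / (1 + s k^m) = c/\<surd>s\<close> for all \<open>s > 0\<close>. By analytic
  continuation this would hold on the slit plane, but the left-hand side blows up at \<open>-1\<close>.\<close>

subsection \<open>First occurrences and the renewal equation\<close>

definition first_occ :: "nat \<Rightarrow> nat list \<Rightarrow> nat \<Rightarrow> nat list set" where
  "first_occ k p t = {w \<in> words t k. suffix p w \<and> \<not> sublist p (butlast w)}"

text \<open>For \<open>d < length p\<close> this set has one element if \<open>d\<close> is a period of \<open>p\<close>, and is empty otherwise.\<close>

definition extensions :: "nat \<Rightarrow> nat list \<Rightarrow> nat \<Rightarrow> nat list set" where
  "extensions k p d = {v \<in> words d k. suffix p (p @ v)}"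

text \<open>In renewal terms, for uniform random letters: \<open>first_prob\<close> is the law of
  the time at which \<open>p\<close> is first completed, \<open>occ_prob\<close> is its distribution
  function (by \<open>occ_prob_eq_sum\<close>), and \<open>return_prob\<close> is the chance that an
  occurrence is followed by one ending \<open>d\<close> letters later.\<close>

definition first_prob :: "nat \<Rightarrow> nat list \<Rightarrow> nat \<Rightarrow> real" where
  "first_prob k p t = real (card (first_occ k p t)) / real k ^ t"

definition occ_prob :: "nat \<Rightarrow> nat list \<Rightarrow> nat \<Rightarrow> real" where
  "occ_prob k p n = real (card {w \<in> words n k. sublist p w}) / real k ^ n"

definition return_prob :: "nat \<Rightarrow> nat list \<Rightarrow> nat \<Rightarrow> real" where
  "return_prob k p d = real (card (extensions k p d)) / real k ^ d"

lemma finite_words [simp, intro]: "finite (words n k)"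
  using finite_lists_length_eq[of "{..<k}" n] by (simp add: words_def conj_commute)

lemma card_words: "card (words n k) = k ^ n"
  using card_lists_length_eq[of "{..<k}" n] by (simp add: words_def conj_commute)

lemma append_in_words: "u \<in> words i k \<Longrightarrow> v \<in> words j k \<Longrightarrow> u @ v \<in> words (i + j) k"
  by (auto simp: words_def)

lemma take_in_words: "w \<in> words n k \<Longrightarrow> t \<le> n \<Longrightarrow> take t w \<in> words t k"
  by (auto simp: words_def dest: in_set_takeD)

lemma drop_in_words: "w \<in> words n k \<Longrightarrow> drop t w \<in> words (n - t) k"
  by (auto simp: words_def dest: in_set_dropD)

lemma finite_first_occ [simp, intro]: "finite (first_occ k p t)"
  by (rule finite_subset[of _ "words t k"]) (auto simp: first_occ_def)

lemma finite_extensions [simp, intro]: "finite (extensions k p d)"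
  by (rule finite_subset[of _ "words d k"]) (auto simp: extensions_def)

text \<open>The first-occurrence words form a prefix code: if one were a proper prefix of another,
  it would lie inside the \<open>butlast\<close> of the longer one, which would then contain
  \<open>p\<close> too early.\<close>

lemma first_occ_append_inj:
  assumes "a \<in> first_occ k p t" "a' \<in> first_occ k p t'" "a @ v = a' @ v'"
  shows "a = a'"
proof -
  have aux: "\<not> length b < length c"
    if b: "b \<in> first_occ k p s" and c: "c \<in> first_occ k p r" and eq: "b @ x = c @ y" for b c s r x y
  proof
    assume less: "length b < length c"
    then obtain z where z: "c = b @ z" "z \<noteq> []"
      using eq by (auto simp: append_eq_append_conv2)
    then have "butlast c = b @ butlast z"
      by (simp add: butlast_append)
    moreover have "sublist p b"
      using b by (auto simp: first_occ_def)
    ultimately have "sublist p (butlast c)"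
      by (simp add: sublist_append)
    then show False
      using c by (simp add: first_occ_def)
  qed
  have "length a = length a'"
    using aux[OF assms] aux[OF assms(2,1) assms(3)[symmetric]] by linarith
  then show ?thesis
    using assms(3) by simp
qed

text \<open>The prefix-code property makes concatenation injective, so cardinalities turn into a
  convolution. Used with \<open>B\<close> the arbitrary continuations and with \<open>B\<close> the
  continuations that end in \<open>p\<close> again.\<close>

lemma card_first_occ_Sigma:
  assumes "\<And>d. finite (B d)"
  shows "card ((\<lambda>(a, v). a @ v) ` (\<Union>t\<le>n. first_occ k p t \<times> B (n - t)))
    = (\<Sum>t\<le>n. card (first_occ k p t) * card (B (n - t)))"
proof -
  have "inj_on (\<lambda>(a, v). a @ v) (\<Union>t\<le>n. first_occ k p t \<times> B (n - t))"
    by (rule inj_onI) (force dest: first_occ_append_inj)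
  then have "card ((\<lambda>(a, v). a @ v) ` (\<Union>t\<le>n. first_occ k p t \<times> B (n - t)))
      = card (\<Union>t\<le>n. first_occ k p t \<times> B (n - t))"
    by (rule card_image)
  also have "\<dots> = (\<Sum>t\<le>n. card (first_occ k p t \<times> B (n - t)))"
    by (rule card_UN_disjoint)
      (use assms in \<open>auto intro!: finite_cartesian_product, auto simp: first_occ_def words_def\<close>)
  finally show ?thesis
    by (simp add: card_cartesian_product)
qed

text \<open>Take the shortest prefix containing \<open>p\<close>. As \<open>p\<close> is nonempty,
  so is this prefix; removing its last letter destroys every occurrence, hence \<open>p\<close> ends
  exactly there.\<close>

lemma first_occ_exists:
  assumes w: "w \<in> words n k" and sub: "sublist p w" and ne: "p \<noteq> []"
  obtains t where "t \<le> n" "take t w \<in> first_occ k p t"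
proof -
  define t where "t = (LEAST t. sublist p (take t w))"
  have len: "length w = n"
    using w by (simp add: words_def)
  then have ex: "sublist p (take n w)"
    using sub by simp
  have t: "sublist p (take t w)"
    unfolding t_def by (rule LeastI[of "\<lambda>t. sublist p (take t w)", OF ex])
  have tn: "t \<le> n"
    unfolding t_def by (rule Least_le[of "\<lambda>t. sublist p (take t w)", OF ex])
  have "t \<noteq> 0"
    using t ne by (metis sublist_Nil_right take_0)
  then obtain s where s: "t = Suc s"
    by (cases t) auto
  have ns: "\<not> sublist p (take s w)"
    using not_less_Least[of s "\<lambda>t. sublist p (take t w)"] s unfolding t_def by simp
  have "s < length w"
    using tn s len by simp
  then have eq: "take t w = take s w @ [w ! s]"
    by (simp add: s take_Suc_conv_app_nth)
  have "suffix p (take t w)"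
    using t ns unfolding eq sublist_snoc by simp
  moreover have "\<not> sublist p (butlast (take t w))"
    using ns unfolding eq by simp
  ultimately have "take t w \<in> first_occ k p t"
    using take_in_words[OF w tn] by (simp add: first_occ_def)
  with tn show ?thesis
    by (rule that)
qed

text \<open>Cut a word containing \<open>p\<close> right after its first occurrence; the remaining
  letters are arbitrary.\<close>

lemma occ_prob_eq_sum:
  assumes k: "k > 0" and ne: "p \<noteq> []"
  shows "occ_prob k p n = (\<Sum>t\<le>n. first_prob k p t)"
proof -
  have "{w \<in> words n k. sublist p w}
      = (\<lambda>(a, v). a @ v) ` (\<Union>t\<le>n. first_occ k p t \<times> words (n - t) k)" (is "?L = ?R")
  proof (intro equalityI subsetI)
    fix w assume w: "w \<in> ?L"
    then obtain t where t: "t \<le> n" "take t w \<in> first_occ k p t"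
      using first_occ_exists[of w n k p] ne by auto
    have "(take t w, drop t w) \<in> (\<Union>t\<le>n. first_occ k p t \<times> words (n - t) k)"
      using t w drop_in_words[of w n k t] by auto
    then have "(\<lambda>(a, v). a @ v) (take t w, drop t w) \<in> ?R"
      by (rule imageI)
    then show "w \<in> ?R"
      by simp
  next
    fix w assume "w \<in> ?R"
    then obtain t a v where *: "t \<le> n" "a \<in> first_occ k p t" "v \<in> words (n - t) k" "w = a @ v"
      by auto
    then have "w \<in> words n k"
      using append_in_words[of a t k v "n - t"] by (simp add: first_occ_def)
    moreover have "sublist p w"
      using * by (simp add: first_occ_def sublist_append)
    ultimately show "w \<in> ?L"
      by simp
  qed
  then have "card {w \<in> words n k. sublist p w} = (\<Sum>t\<le>n. card (first_occ k p t) * k ^ (n - t))"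
    using card_first_occ_Sigma[of "\<lambda>d. words d k" k p n] by (simp add: card_words)
  then have "occ_prob k p n
      = (\<Sum>t\<le>n. real (card (first_occ k p t)) * real k ^ (n - t) / real k ^ n)"
    by (simp add: occ_prob_def sum_divide_distrib)
  also have "\<dots> = (\<Sum>t\<le>n. first_prob k p t)"
    by (rule sum.cong) (use k in \<open>auto simp: first_prob_def power_diff field_simps\<close>)
  finally show ?thesis .
qed

lemma card_suffix_words:
  assumes p: "p \<in> words m k" and n: "m \<le> n"
  shows "card {w \<in> words n k. suffix p w} = k ^ (n - m)"
proof -
  have "{w \<in> words n k. suffix p w} = (\<lambda>u. u @ p) ` words (n - m) k"
  proof (intro equalityI subsetI)
    fix w assume "w \<in> {w \<in> words n k. suffix p w}"
    then obtain u where "w = u @ p" "w \<in> words n k"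
      by (auto elim: suffixE)
    then show "w \<in> (\<lambda>u. u @ p) ` words (n - m) k"
      using p by (auto simp: words_def)
  next
    fix w assume "w \<in> (\<lambda>u. u @ p) ` words (n - m) k"
    then show "w \<in> {w \<in> words n k. suffix p w}"
      using append_in_words[OF _ p, of _ "n - m"] n by (auto simp: suffix_def)
  qed
  then show ?thesis
    by (simp add: card_image inj_on_def card_words)
qed

text \<open>Count the words of length \<open>n\<close> that end in \<open>p\<close> in two ways:
  directly, and by cutting them after the first occurrence of \<open>p\<close>.\<close>

lemma renewal_equation:
  assumes k: "k > 0" and p: "p \<in> words m k" and m: "m > 0" and n: "m \<le> n"
  shows "(\<Sum>t\<le>n. first_prob k p t * return_prob k p (n - t)) = 1 / real k ^ m"
proof -
  have ne: "p \<noteq> []"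
    using p m by (auto simp: words_def)
  \<comment> \<open>Whether \<open>p\<close> ends \<open>a @ v\<close> depends on \<open>a\<close>
    only through its suffix \<open>p\<close>, because \<open>p @ v\<close> is already a suffix of
    \<open>a @ v\<close> that is at least as long as \<open>p\<close>.\<close>
  have ext: "suffix p (a @ v) \<longleftrightarrow> suffix p (p @ v)" if "suffix p a" for a v
  proof -
    have "suffix (p @ v) (a @ v)"
      using that by simp
    then show ?thesis
      using suffix_length_suffix[of p "a @ v" "p @ v"] suffix_order.trans[of p "p @ v" "a @ v"] by auto
  qed
  have "{w \<in> words n k. suffix p w}
      = (\<lambda>(a, v). a @ v) ` (\<Union>t\<le>n. first_occ k p t \<times> extensions k p (n - t))" (is "?L = ?R")
  proof (intro equalityI subsetI)
    fix w assume w: "w \<in> ?L"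
    then obtain t where t: "t \<le> n" "take t w \<in> first_occ k p t"
      using first_occ_exists[of w n k p] ne by auto
    have "drop t w \<in> extensions k p (n - t)"
      using w t ext[of "take t w" "drop t w"] drop_in_words[of w n k t]
      by (simp add: extensions_def first_occ_def)
    then have "(take t w, drop t w) \<in> (\<Union>t\<le>n. first_occ k p t \<times> extensions k p (n - t))"
      using t by auto
    then have "(\<lambda>(a, v). a @ v) (take t w, drop t w) \<in> ?R"
      by (rule imageI)
    then show "w \<in> ?R"
      by simp
  next
    fix w assume "w \<in> ?R"
    then obtain t a v where *: "t \<le> n" "a \<in> first_occ k p t" "v \<in> extensions k p (n - t)"
      "w = a @ v"
      by auto
    then have "w \<in> words n k"
      using append_in_words[of a t k v "n - t"] by (simp add: first_occ_def extensions_def)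
    moreover have "suffix p w"
      using * ext[of a v] by (simp add: first_occ_def extensions_def)
    ultimately show "w \<in> ?L"
      by simp
  qed
  then have "k ^ (n - m) = (\<Sum>t\<le>n. card (first_occ k p t) * card (extensions k p (n - t)))"
    using card_suffix_words[OF p n] card_first_occ_Sigma[of "extensions k p" k p n] by simp
  then have "real k ^ (n - m) / real k ^ n
      = (\<Sum>t\<le>n. real (card (first_occ k p t)) * real (card (extensions k p (n - t))) / real k ^ n)"
    by (simp flip: of_nat_power add: sum_divide_distrib)
  also have "\<dots> = (\<Sum>t\<le>n. first_prob k p t * return_prob k p (n - t))"
    by (rule sum.cong) (auto simp: first_prob_def return_prob_def simp flip: power_add)
  finally show ?thesis
    using k n by (simp add: power_diff)
qed

lemma first_prob_nonneg: "0 \<le> first_prob k p t"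
  by (simp add: first_prob_def)

lemma return_prob_nonneg: "0 \<le> return_prob k p t"
  by (simp add: return_prob_def)

lemma first_prob_eq_0: "p \<in> words m k \<Longrightarrow> t < m \<Longrightarrow> first_prob k p t = 0"
proof -
  assume "p \<in> words m k" "t < m"
  then have "first_occ k p t = {}"
    by (auto simp: first_occ_def words_def suffix_def)
  then show ?thesis
    by (simp add: first_prob_def)
qed

lemma return_prob_0 [simp]: "return_prob k p 0 = 1"
proof -
  have "extensions k p 0 = {[]}"
    by (auto simp: extensions_def words_def)
  then show ?thesis
    by (simp add: return_prob_def)
qed

text \<open>Comparing the ends of \<open>p @ v = z @ p\<close> forces \<open>v\<close> to be the
  last \<open>d\<close> letters of \<open>p\<close>.\<close>

lemma card_extensions_le_1:
  assumes p: "p \<in> words m k" and d: "d \<le> m"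
  shows "card (extensions k p d) \<le> 1"
proof -
  have "v = drop (m - d) p" if "v \<in> extensions k p d" for v
  proof -
    from that obtain z where z: "p @ v = z @ p" and "length v = d"
      by (auto simp: extensions_def words_def suffix_def)
    moreover have "length z = d"
      using z \<open>length v = d\<close> by (metis add.commute add_left_cancel length_append)
    moreover have "drop m (p @ v) = v" "drop m (z @ p) = drop (m - d) p"
      using p d \<open>length z = d\<close> by (auto simp: words_def)
    ultimately show ?thesis
      by metis
  qed
  then have "extensions k p d \<subseteq> {drop (m - d) p}"
    by auto
  then show ?thesis
    using card_mono[of "{drop (m - d) p}"] by simp
qed

lemma return_prob_le:
  assumes "p \<in> words m k" "d \<le> m"
  shows "return_prob k p d \<le> 1 / real k ^ d"
  unfolding return_prob_def
  by (rule divide_right_mono) (use card_extensions_le_1[OF assms] in auto)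

text \<open>After at least \<open>m\<close> new letters the new copy of \<open>p\<close> lies
  entirely among them, so it does not interact with the old one.\<close>

lemma return_prob_ge_length:
  assumes p: "p \<in> words m k" and d: "m \<le> d" and k: "k > 0"
  shows "return_prob k p d = 1 / real k ^ m"
proof -
  have "suffix p (p @ v) \<longleftrightarrow> suffix p v" if "length v = d" for v
    using that p d suffix_length_suffix[of p "p @ v" v]
    by (auto simp: words_def suffix_appendI)
  then have "extensions k p d = {v \<in> words d k. suffix p v}"
    by (auto simp: extensions_def words_def)
  then show ?thesis
    using card_suffix_words[OF p d] k d by (simp add: return_prob_def) (simp add: power_diff)
qed

lemma occ_prob_nonneg: "0 \<le> occ_prob k p n"
  by (simp add: occ_prob_def)

lemma occ_prob_le_1: "occ_prob k p n \<le> 1"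
proof -
  have "card {w \<in> words n k. sublist p w} \<le> k ^ n"
    unfolding card_words[symmetric] by (rule card_mono) auto
  then have "real (card {w \<in> words n k. sublist p w}) \<le> real k ^ n"
    by (simp flip: of_nat_power)
  then show ?thesis
    \<comment> \<open>For \<open>k = 0\<close> and \<open>n > 0\<close> the denominator vanishes and
      the quotient is 0 by convention.\<close>
    unfolding occ_prob_def by (cases "real k ^ n = 0") (auto simp: divide_le_eq_1)
qed

text \<open>The summand of the renewal equation with \<open>return_prob k p 0 = 1\<close> is
  \<open>first_prob k p t\<close> itself.\<close>

lemma first_prob_le:
  assumes k: "k > 0" and p: "p \<in> words m k" and m: "m > 0"
  shows "first_prob k p t \<le> 1 / real k ^ m"
proof (cases "t < m")
  case True
  then show ?thesis
    using first_prob_eq_0[OF p] by simp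
next
  case False
  have "first_prob k p t = first_prob k p t * return_prob k p (t - t)"
    by simp
  also have "\<dots> \<le> (\<Sum>i\<le>t. first_prob k p i * return_prob k p (t - i))"
    by (rule member_le_sum) (auto intro: mult_nonneg_nonneg first_prob_nonneg return_prob_nonneg)
  also have "\<dots> = 1 / real k ^ m"
    using renewal_equation[OF k p m] False by simp
  finally show ?thesis .
qed

lemma occ_prob_upper:
  assumes k: "k > 0" and p: "p \<in> words m k" and m: "m > 0"
  shows "occ_prob k p n \<le> real n / real k ^ m"
proof -
  have ne: "p \<noteq> []"
    using p m by (auto simp: words_def)
  have "occ_prob k p n = (\<Sum>t\<in>{1..n}. first_prob k p t)"
    unfolding occ_prob_eq_sum[OF k ne]
    by (rule sum.mono_neutral_right) (use m first_prob_eq_0[OF p] in \<open>auto simp: Suc_le_eq\<close>)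
  also have "\<dots> \<le> (\<Sum>t\<in>{1..n}. 1 / real k ^ m)"
    by (rule sum_mono) (rule first_prob_le[OF k p m])
  finally show ?thesis
    by simp
qed

text \<open>Overlapping returns (\<open>d \<le> m\<close>) are dominated by the geometric series of
  ratio 1/2, which gives the 2; each of the at most \<open>n\<close> later ones contributes
  \<open>k^-m\<close>.\<close>

lemma sum_return_prob_le:
  assumes k: "k \<ge> 2" and p: "p \<in> words m k" and m: "m > 0"
  shows "(\<Sum>d\<le>n. return_prob k p d) \<le> 2 + real n / real k ^ m"
proof -
  have "(\<Sum>d\<le>n. return_prob k p d) \<le> (\<Sum>d\<le>n. (1/2) ^ d + (if d = 0 then 0 else 1 / real k ^ m))"
  proof (rule sum_mono)
    fix d
    show "return_prob k p d \<le> (1/2) ^ d + (if d = 0 then 0 else 1 / real k ^ m)"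
    proof (cases "d \<le> m")
      case True
      have "return_prob k p d \<le> 1 / real k ^ d"
        by (rule return_prob_le[OF p True])
      also have "\<dots> \<le> 1 / 2 ^ d"
        using k by (intro divide_left_mono power_mono) auto
      finally show ?thesis
        by (auto simp: power_divide intro: add_increasing2)
    next
      case False
      then show ?thesis
        using return_prob_ge_length[OF p, of d] k m by (auto intro: add_increasing)
    qed
  qed
  also have "\<dots> = (\<Sum>d\<le>n. (1/2) ^ d) + (\<Sum>d\<le>n. if d = 0 then 0 else 1 / real k ^ m)"
    by (rule sum.distrib)
  also have "(\<Sum>d\<le>n. if d = 0 then 0 else 1 / real k ^ m) = real n / real k ^ m"
    by (induction n) (simp_all add: add_divide_distrib)
  also have "(\<Sum>d\<le>n. (1/2::real) ^ d) \<le> 2"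
    unfolding sum_gp0 by simp
  finally show ?thesis
    by simp
qed

text \<open>Sum the renewal equation over all end places from \<open>m\<close> to \<open>n\<close>
  and exchange the sums: each first occurrence accounts for at most \<open>2 + n / k^m\<close>
  expected occurrences.\<close>

lemma occ_prob_lower:
  assumes k: "k \<ge> 2" and p: "p \<in> words m k" and m: "m > 0" and n: "m \<le> n"
  shows "real (n + 1 - m) / (2 * real k ^ m + real n) \<le> occ_prob k p n"
proof -
  have k0: "k > 0"
    using k by simp
  have ne: "p \<noteq> []"
    using p m by (auto simp: words_def)
  have "real (n + 1 - m) / real k ^ m = (\<Sum>l\<in>{m..n}. 1 / real k ^ m)"
    by simp
  also have "\<dots> = (\<Sum>l\<in>{m..n}. \<Sum>t\<le>l. first_prob k p t * return_prob k p (l - t))"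
    by (rule sum.cong) (use renewal_equation[OF k0 p m] in auto)
  also have "\<dots> \<le> (\<Sum>l\<le>n. \<Sum>t\<le>l. first_prob k p t * return_prob k p (l - t))"
    by (rule sum_mono2) (auto intro!: sum_nonneg mult_nonneg_nonneg first_prob_nonneg return_prob_nonneg)
  also have "\<dots> = (\<Sum>t\<le>n. \<Sum>l\<in>{t..n}. first_prob k p t * return_prob k p (l - t))"
    by (subst sum.Sigma, simp, simp, subst sum.Sigma, simp, simp,
        rule sum.reindex_bij_witness[of _ prod.swap prod.swap]) auto
  also have "\<dots> \<le> (\<Sum>t\<le>n. first_prob k p t * (2 + real n / real k ^ m))"
  proof (rule sum_mono)
    fix t assume t: "t \<in> {..n}"
    have "(\<Sum>l\<in>{t..n}. return_prob k p (l - t)) = (\<Sum>d\<le>n - t. return_prob k p d)"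
      by (rule sum.reindex_bij_witness[of _ "\<lambda>d. d + t" "\<lambda>l. l - t"]) (use t in auto)
    also have "\<dots> \<le> 2 + real (n - t) / real k ^ m"
      by (rule sum_return_prob_le[OF k p m])
    also have "\<dots> \<le> 2 + real n / real k ^ m"
      by (simp add: divide_right_mono)
    finally show "(\<Sum>l\<in>{t..n}. first_prob k p t * return_prob k p (l - t))
        \<le> first_prob k p t * (2 + real n / real k ^ m)"
      unfolding sum_distrib_left[symmetric]
      by (rule mult_left_mono) (rule first_prob_nonneg)
  qed
  also have "\<dots> = occ_prob k p n * (2 + real n / real k ^ m)"
    by (simp add: occ_prob_eq_sum[OF k0 ne] sum_distrib_right)
  finally have "real (n + 1 - m) / real k ^ m \<le> occ_prob k p n * (2 + real n / real k ^ m)" .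
  then have "real (n + 1 - m) \<le> occ_prob k p n * (2 * real k ^ m + real n)"
    using k0 by (simp add: field_simps)
  moreover have "2 * real k ^ m + real n > 0"
    using k0 by (simp add: add_pos_nonneg)
  ultimately show ?thesis
    by (simp add: field_simps)
qed

text \<open>A single word may overlap itself heavily, but a pair \<open>(p, v)\<close> with
  \<open>v\<close> an extension of \<open>p\<close> is determined by \<open>v\<close>. This controls
  the self-overlaps on average over any set of words of equal length.\<close>

lemma sum_card_extensions_le:
  assumes d: "d > 0" and P: "P \<subseteq> words m k"
  shows "(\<Sum>p\<in>P. card (extensions k p d)) \<le> k ^ d"
proof -
  have fin: "finite P"
    using P finite_subset by blast
  \<comment> \<open>\<open>p\<close> has the period \<open>d\<close>, so it is a suffix of a power of \<open>v\<close>.\<close>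
  have det: "p = drop (length (concat (replicate m v)) - m) (concat (replicate m v))"
    if "p \<in> P" "v \<in> extensions k p d" for p v
  proof -
    have 1: "suffix p (p @ v)" and v: "length v = d"
      using that by (auto simp: extensions_def words_def)
    have snoc: "concat (replicate (Suc j) v) = concat (replicate j v) @ v" for j
      by (induction j) auto
    have "suffix p (p @ concat (replicate j v))" for j
    proof (induction j)
      case (Suc j)
      have "suffix (p @ v) ((p @ concat (replicate j v)) @ v)"
        using Suc by (simp only: same_suffix_suffix)
      then show ?case
        using 1 suffix_order.trans[of p "p @ v"] snoc[of j] by (metis append_assoc)
    qed simp
    then have "suffix p (p @ concat (replicate m v))" .
    moreover have len: "length (concat (replicate m v)) = m * d"
      using v by (simp add: length_concat sum_list_replicate)
    moreover have pm: "length p = m"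
      using P that by (auto simp: words_def)
    \<comment> \<open>Since \<open>d > 0\<close>, the power of \<open>v\<close> has length
      \<open>m * d \<ge> m\<close>, long enough to contain all of \<open>p\<close>.\<close>
    ultimately have "suffix p (concat (replicate m v))"
      using d suffix_length_suffix[of p "p @ concat (replicate m v)" "concat (replicate m v)"]
      by (auto simp: suffix_def)
    then obtain z where "concat (replicate m v) = z @ p"
      by (auto simp: suffix_def)
    then show ?thesis
      using pm by simp
  qed
  have "inj_on snd (Sigma P (\<lambda>p. extensions k p d))"
    by (rule inj_onI, clarsimp) (metis det)
  moreover have "snd ` Sigma P (\<lambda>p. extensions k p d) \<subseteq> words d k"
    by (auto simp: extensions_def)
  ultimately have "card (Sigma P (\<lambda>p. extensions k p d)) \<le> card (words d k)"
    using card_inj_on_le[of snd "Sigma P (\<lambda>p. extensions k p d)" "words d k"] by simp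
  then show ?thesis
    using fin by (simp add: card_SigmaI card_words)
qed

section \<open>Counting palindromes and splitting the richness by length\<close>

definition palindromes :: "nat \<Rightarrow> nat \<Rightarrow> nat list set" where
  "palindromes m k = {p \<in> words m k. palindrome p}"

lemma finite_palindromes [simp, intro]: "finite (palindromes m k)"
  by (simp add: palindromes_def)

text \<open>A palindrome is determined by its first half, rounded up. The inverse map reflects only
  the first \<open>m div 2\<close> letters, so that the middle letter of an odd palindrome is not
  repeated.\<close>

lemma card_palindromes:
  assumes m: "m > 0"
  shows "card (palindromes m k) = k ^ ((m + 1) div 2)"
proof -
  let ?h = "(m + 1) div 2"
  have "bij_betw (take ?h) (palindromes m k) (words ?h k)"
  proof (rule bij_betw_byWitness[where f' = "\<lambda>u. u @ rev (take (m div 2) u)"])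
    show "\<forall>p\<in>palindromes m k. take ?h p @ rev (take (m div 2) (take ?h p)) = p"
    proof
      fix p assume "p \<in> palindromes m k"
      then have p: "length p = m" "rev p = p"
        by (auto simp: palindromes_def palindrome_def words_def)
      have "rev (take (m div 2) p) = drop (m - m div 2) p"
        using p by (metis rev_take)
      moreover have "m - m div 2 = ?h" "min (m div 2) ?h = m div 2"
        by linarith+
      ultimately show "take ?h p @ rev (take (m div 2) (take ?h p)) = p"
        by (simp add: min.commute)
    qed
    show "\<forall>u\<in>words ?h k. take ?h (u @ rev (take (m div 2) u)) = u"
      by (auto simp: words_def)
    show "take ?h ` palindromes m k \<subseteq> words ?h k"
      by (auto simp: palindromes_def intro!: take_in_words[of _ m])
    show "(\<lambda>u. u @ rev (take (m div 2) u)) ` words ?h k \<subseteq> palindromes m k"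
    proof
      fix w assume "w \<in> (\<lambda>u. u @ rev (take (m div 2) u)) ` words ?h k"
      then obtain u where u: "u \<in> words ?h k" "w = u @ rev (take (m div 2) u)"
        by auto
      have len: "length u = ?h"
        using u by (simp add: words_def)
      have lw: "length w = m"
        using u len by simp
      have "set w \<subseteq> {..<k}"
        using u by (auto simp: words_def dest: in_set_takeD)
      then have ww: "w \<in> words m k"
        using lw by (simp add: words_def)
      have "rev w = take (m div 2) u @ rev u"
        using u by simp
      \<comment> \<open>\<open>drop (m div 2) u\<close> is empty for even \<open>m\<close> and is
        the middle letter for odd \<open>m\<close>.\<close>
      also have "rev u = drop (m div 2) u @ rev (take (m div 2) u)"
      proof (cases "even m")
        case True
        then have "?h = m div 2"
          by auto
        then show ?thesis
          using len by simp
      next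
        case False
        then have h: "?h = Suc (m div 2)"
          by presburger
        then have uu: "u = take (m div 2) u @ [u ! (m div 2)]"
          using len by (metis lessI take_Suc_conv_app_nth take_all order_refl)
        then have "rev u = u ! (m div 2) # rev (take (m div 2) u)"
          by (metis rev.simps(2) rev_rev_ident rev_append append_Cons append_Nil rev_singleton_conv)
        moreover have "drop (m div 2) u = [u ! (m div 2)]"
          using h len by (metis Cons_nth_drop_Suc drop_all lessI order_refl)
        ultimately show ?thesis
          by simp
      qed
      finally have "rev w = w"
        using u(2) by (simp flip: append_assoc)
      moreover have "w \<noteq> []"
        using lw m by auto
      ultimately show "w \<in> palindromes m k"
        using ww by (simp add: palindromes_def palindrome_def)
    qed
  qed
  then show ?thesis
    by (simp add: bij_betw_same_card card_words)
qed

definition level_richness :: "nat \<Rightarrow> nat \<Rightarrow> nat \<Rightarrow> real" where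
  "level_richness k m n = (\<Sum>p\<in>palindromes m k. occ_prob k p n)"

lemma level_richness_nonneg: "0 \<le> level_richness k m n"
  unfolding level_richness_def by (intro sum_nonneg occ_prob_nonneg)

text \<open>Linearity of expectation over the finite set \<open>Q\<close> of candidate palindromes;
  a factor of a word of length \<open>n\<close> has length at most \<open>n\<close>.\<close>

lemma expected_richness_eq:
  assumes k: "k > 0"
  shows "expected_richness n k = (\<Sum>m\<in>{1..n}. level_richness k m n)"
proof -
  have ne: "words n k \<noteq> {}"
    using card_words[of n k] k by (metis card.empty less_irrefl zero_less_power)
  define Q where "Q = (\<Union>m\<in>{1..n}. palindromes m k)"
  have fQ: "finite Q"
    by (simp add: Q_def)
  have R: "real (palindromic_richness w) = (\<Sum>p\<in>Q. if sublist p w then 1 else 0)"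
    if w: "w \<in> words n k" for w
  proof -
    have "{p. palindrome p \<and> sublist p w} = {p \<in> Q. sublist p w}"
    proof (intro equalityI subsetI)
      fix p assume "p \<in> {p. palindrome p \<and> sublist p w}"
      then have p: "palindrome p" "sublist p w"
        by auto
      then have "length p \<le> n" "set p \<subseteq> {..<k}" "length p \<ge> 1"
        using w sublist_length_le[of p w] set_mono_sublist[of p w]
        by (auto simp: words_def palindrome_def Suc_le_eq)
      then have "p \<in> Q"
        unfolding Q_def using p
        by (intro UN_I[of "length p"]) (auto simp: palindromes_def words_def)
      with p show "p \<in> {p \<in> Q. sublist p w}"
        by simp
    qed (auto simp: Q_def palindromes_def)
    then show ?thesis
      using fQ by (simp add: palindromic_richness_def sum.If_cases Int_def)
  qed
  have "expected_richness n k = (\<Sum>w\<in>words n k. real (palindromic_richness w)) / real k ^ n"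
    unfolding expected_richness_def using ne
    by (subst integral_pmf_of_set) (auto simp: card_words)
  also have "(\<Sum>w\<in>words n k. real (palindromic_richness w))
      = (\<Sum>w\<in>words n k. \<Sum>p\<in>Q. if sublist p w then 1 else 0)"
    by (rule sum.cong) (auto simp: R)
  also have "\<dots> = (\<Sum>p\<in>Q. \<Sum>w\<in>words n k. if sublist p w then 1 else 0)"
    by (rule sum.swap)
  also have "\<dots> = (\<Sum>p\<in>Q. real (card {w \<in> words n k. sublist p w}))"
    by (rule sum.cong) (auto simp: sum.If_cases Int_def)
  also have "\<dots> / real k ^ n = (\<Sum>p\<in>Q. occ_prob k p n)"
    by (simp add: sum_divide_distrib occ_prob_def)
  also have "\<dots> = (\<Sum>m\<in>{1..n}. level_richness k m n)"
    unfolding Q_def level_richness_def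
    by (rule sum.UNION_disjoint) (auto, auto simp: palindromes_def words_def)
  finally show ?thesis .
qed

subsection \<open>Bounds for the expected richness\<close>

lemma level_richness_lower:
  assumes k: "k \<ge> 2" and m: "m > 0" and n: "m \<le> n"
  shows "real k ^ ((m + 1) div 2) * (real (n + 1 - m) / (2 * real k ^ m + real n))
    \<le> level_richness k m n"
proof -
  have "real (card (palindromes m k)) * (real (n + 1 - m) / (2 * real k ^ m + real n))
      \<le> (\<Sum>p\<in>palindromes m k. occ_prob k p n)"
    by (rule sum_bounded_below) (use occ_prob_lower[OF k _ m n] in \<open>auto simp: palindromes_def\<close>)
  then show ?thesis
    by (simp add: card_palindromes[OF m] level_richness_def)
qed

lemma level_richness_upper:
  assumes k: "k \<ge> 2" and m: "m > 0"
  shows "level_richness k m n \<le> real k ^ ((m + 1) div 2) * min 1 (real n / real k ^ m)"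
proof -
  have "(\<Sum>p\<in>palindromes m k. occ_prob k p n)
      \<le> real (card (palindromes m k)) * min 1 (real n / real k ^ m)"
    by (rule sum_bounded_above)
      (use occ_prob_upper[of k _ m n] occ_prob_le_1 k m in \<open>auto simp: palindromes_def\<close>)
  then show ?thesis
    by (simp add: card_palindromes[OF m] level_richness_def)
qed

text \<open>\<open>A\<close> is the crossover of the minimum: up to \<open>A\<close> the terms are
  at most \<open>k^j\<close>, beyond it at most \<open>y / k^j\<close>. Both are geometric with
  ratio at least 2 in the favourable direction, so each half is at most twice its extreme term,
  hence at most \<open>2 * X\<close>.\<close>

lemma sum_min_geometric_le:
  fixes k y X :: real
  assumes k: "k \<ge> 2" and y: "0 \<le> y" and A: "k ^ A \<le> X" "y / k ^ Suc A \<le> X"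
  shows "(\<Sum>j\<in>{1..N}. k ^ j * min 1 (y / k ^ (2 * j))) \<le> 4 * X"
proof -
  have t1: "k ^ j * min 1 (y / k ^ (2 * j)) \<le> k ^ j" for j
    using k by (simp add: mult_left_le)
  have t2: "k ^ j * min 1 (y / k ^ (2 * j)) \<le> y / k ^ j" for j
  proof -
    have "k ^ j * min 1 (y / k ^ (2 * j)) \<le> k ^ j * (y / k ^ (2 * j))"
      using k by (intro mult_left_mono) auto
    also have "\<dots> = y / k ^ j"
      using k by (simp add: mult_2 power_add)
    finally show ?thesis .
  qed
  have nonneg: "0 \<le> k ^ j * min 1 (y / k ^ (2 * j))" for j
    using k y by simp
  have s1: "(\<Sum>j\<le>A. k ^ j) \<le> 2 * k ^ A"
  proof (induction A)
    case (Suc A)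
    have "2 * k ^ A \<le> k * k ^ A"
      using k by (intro mult_right_mono) auto
    with Suc show ?case
      by simp
  qed simp
  have "(\<Sum>i\<le>N. (1 / k) ^ i) \<le> (\<Sum>i\<le>N. (1 / 2) ^ i)"
    using k by (intro sum_mono power_mono divide_left_mono) auto
  also have "(\<Sum>i\<le>N. (1 / 2 :: real) ^ i) \<le> 2"
    unfolding sum_gp0 by simp
  finally have "(\<Sum>i\<le>N. (1 / k) ^ i) * (y / k ^ Suc A) \<le> 2 * (y / k ^ Suc A)"
    by (rule mult_right_mono) (use k y in auto)
  moreover have "(\<Sum>i\<le>N. y / k ^ (i + Suc A)) = (\<Sum>i\<le>N. (1 / k) ^ i) * (y / k ^ Suc A)"
    unfolding sum_distrib_right by (rule sum.cong) (simp_all add: power_add power_divide)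
  ultimately have s2: "(\<Sum>i\<le>N. y / k ^ (i + Suc A)) \<le> 2 * (y / k ^ Suc A)"
    by simp
  have "(\<Sum>j\<in>{1..N}. k ^ j * min 1 (y / k ^ (2 * j)))
      \<le> (\<Sum>j\<in>{..A} \<union> (\<lambda>i. i + Suc A) ` {..N}. k ^ j * min 1 (y / k ^ (2 * j)))"
  proof (rule sum_mono2)
    show "{1..N} \<subseteq> {..A} \<union> (\<lambda>i. i + Suc A) ` {..N}"
    proof
      fix j assume j: "j \<in> {1..N}"
      show "j \<in> {..A} \<union> (\<lambda>i. i + Suc A) ` {..N}"
      proof (cases "j \<le> A")
        case False
        then have "j = (j - Suc A) + Suc A" "j - Suc A \<in> {..N}"
          using j by auto
        then show ?thesis
          by blast
      qed auto
    qed
  qed (use nonneg in auto)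
  also have "\<dots> = (\<Sum>j\<le>A. k ^ j * min 1 (y / k ^ (2 * j)))
      + (\<Sum>j\<in>(\<lambda>i. i + Suc A) ` {..N}. k ^ j * min 1 (y / k ^ (2 * j)))"
    by (rule sum.union_disjoint) auto
  also have "(\<Sum>j\<in>(\<lambda>i. i + Suc A) ` {..N}. k ^ j * min 1 (y / k ^ (2 * j)))
      = (\<Sum>i\<le>N. k ^ (i + Suc A) * min 1 (y / k ^ (2 * (i + Suc A))))"
    by (subst sum.reindex) (auto simp: inj_on_def)
  also have "\<dots> \<le> (\<Sum>i\<le>N. y / k ^ (i + Suc A))"
    by (rule sum_mono) (rule t2)
  also have "(\<Sum>j\<le>A. k ^ j * min 1 (y / k ^ (2 * j))) \<le> (\<Sum>j\<le>A. k ^ j)"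
    by (rule sum_mono) (rule t1)
  finally show ?thesis
    using s1 s2 A by linarith
qed

text \<open>The lengths \<open>2 * j\<close> and \<open>2 * j - 1\<close> both have
  \<open>k^j\<close> palindromes, and \<open>n / k^(2j-1) = n k / k^(2j)\<close>. Thus odd lengths
  behave like even ones with \<open>n\<close> replaced by \<open>n k\<close>.\<close>

lemma expected_richness_le_split:
  assumes k: "k \<ge> 2"
  shows "expected_richness n k \<le>
    (\<Sum>j\<in>{1..n}. real k ^ j * min 1 (real n / real k ^ (2 * j))) +
    (\<Sum>j\<in>{1..n}. real k ^ j * min 1 (real n * real k / real k ^ (2 * j)))"
proof -
  define g where "g m = real k ^ ((m + 1) div 2) * min 1 (real n / real k ^ m)" for m
  have pairs: "(\<Sum>m\<in>{1..2*N}. g m) = (\<Sum>j\<in>{1..N}. g (2 * j) + g (2 * j - 1))" for N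
    by (induction N) simp_all
  have "expected_richness n k \<le> (\<Sum>m\<in>{1..n}. g m)"
    unfolding g_def using k level_richness_upper[of k]
    by (subst expected_richness_eq) (auto intro!: sum_mono)
  \<comment> \<open>The range is doubled only to let the lengths fall into complete pairs.\<close>
  also have "\<dots> \<le> (\<Sum>m\<in>{1..2*n}. g m)"
    by (rule sum_mono2) (auto simp: g_def)
  also have "\<dots> = (\<Sum>j\<in>{1..n}. g (2 * j) + g (2 * j - 1))"
    by (rule pairs)
  also have "\<dots> =
    (\<Sum>j\<in>{1..n}. real k ^ j * min 1 (real n / real k ^ (2 * j)) +
      real k ^ j * min 1 (real n * real k / real k ^ (2 * j)))"
  proof (rule sum.cong)
    fix j assume "j \<in> {1..n}"
    then obtain i where "j = Suc i"
      by (cases j) auto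
    then show "g (2 * j) + g (2 * j - 1) =
        real k ^ j * min 1 (real n / real k ^ (2 * j)) +
        real k ^ j * min 1 (real n * real k / real k ^ (2 * j))"
      using k by (simp add: g_def)
  qed simp
  finally show ?thesis
    by (simp add: sum.distrib)
qed

lemma ex_power_sqrt_bounds:
  assumes k: "k \<ge> 2" and n: "n > 0"
  obtains j where "real k ^ j \<le> sqrt (real n)" "sqrt (real n) \<le> real k ^ Suc j"
proof -
  have 1: "sqrt (real n) \<ge> 1"
    using n by simp
  define r where "r = nat \<lfloor>sqrt (real n)\<rfloor>"
  have r: "real r \<le> sqrt (real n)" "sqrt (real n) < real (r + 1)" "r \<ge> 1"
    using 1 unfolding r_def by (linarith+)
  obtain j where j: "k ^ j \<le> r" "r < k ^ (j + 1)"
    using ex_power_ivl1[OF k r(3)] by auto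
  have "real (k ^ j) \<le> real r" "real (r + 1) \<le> real (k ^ (j + 1))"
    using j unfolding of_nat_le_iff by simp_all
  then have "real k ^ j \<le> sqrt (real n)" "sqrt (real n) \<le> real k ^ Suc j"
    using r unfolding of_nat_power Suc_eq_plus1 by linarith+
  then show ?thesis
    by (rule that)
qed

text \<open>The even lengths contribute at most \<open>4 * sqrt n\<close>, the odd ones at most
  \<open>4 * sqrt (n k)\<close>; the odd lengths are the source of the factor
  \<open>sqrt k\<close>.\<close>

lemma expected_richness_upper:
  assumes k: "k \<ge> 2"
  shows "expected_richness n k \<le> 8 * sqrt (real k) * sqrt (real n)"
proof (cases "n = 0")
  case False
  have *: "(\<Sum>j\<in>{1..n}. real k ^ j * min 1 (real y / real k ^ (2 * j))) \<le> 4 * sqrt (real y)"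
    if "y > 0" for y
  proof -
    obtain A where A: "real k ^ A \<le> sqrt (real y)" "sqrt (real y) \<le> real k ^ Suc A"
      using ex_power_sqrt_bounds[OF k \<open>y > 0\<close>] by blast
    have "real y = sqrt (real y) * sqrt (real y)"
      by simp
    also have "\<dots> \<le> sqrt (real y) * real k ^ Suc A"
      using A by (intro mult_left_mono) auto
    finally have "real y / real k ^ Suc A \<le> sqrt (real y)"
      using k by (simp add: field_simps)
    then show ?thesis
      using sum_min_geometric_le[of "real k" "real y" A "sqrt (real y)" n] A k by simp
  qed
  have "expected_richness n k \<le> 4 * sqrt (real n) + 4 * sqrt (real (n * k))"
    using expected_richness_le_split[OF k, of n] *[of n] *[of "n * k"] False k by simp
  also have "\<dots> \<le> 4 * (sqrt (real k) * sqrt (real n)) + 4 * sqrt (real (n * k))"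
    using k mult_right_mono[of 1 "sqrt (real k)" "sqrt (real n)"] by simp
  finally show ?thesis
    by (simp add: real_sqrt_mult mult_ac)
next
  case True
  then show ?thesis
    using k by (simp add: expected_richness_eq)
qed

text \<open>At even powers of \<open>k\<close> the same crossover \<open>A\<close> serves both
  parities, because \<open>n k / k^(A+1) = k^A\<close>; hence no factor \<open>sqrt k\<close> is
  lost.\<close>

lemma expected_richness_upper_even_power:
  assumes k: "k \<ge> 2"
  shows "expected_richness (k ^ (2 * A)) k \<le> 8 * sqrt (real (k ^ (2 * A)))"
proof -
  have *: "(\<Sum>j\<in>{1..n}. real k ^ j * min 1 (y / real k ^ (2 * j))) \<le> 4 * real k ^ A"
    if "0 \<le> y" "y / real k ^ Suc A \<le> real k ^ A" for n y
    by (rule sum_min_geometric_le) (use that k in auto)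
  have 1: "real k ^ (2 * A) / real k ^ Suc A \<le> real k ^ A"
    using k by (simp add: field_simps mult_2 mult_2_right power_add)
  have 2: "real k ^ (2 * A) * real k / real k ^ Suc A \<le> real k ^ A"
    using k by (simp add: field_simps mult_2 mult_2_right power_add)
  have "expected_richness (k ^ (2 * A)) k \<le> 4 * real k ^ A + 4 * real k ^ A"
    using expected_richness_le_split[OF k, of "k ^ (2 * A)"]
      *[of "real k ^ (2 * A)" "k ^ (2 * A)"] *[of "real k ^ (2 * A) * real k" "k ^ (2 * A)"] 1 2
    by simp
  moreover have "sqrt (real (k ^ (2 * A))) = real k ^ A"
    by (simp add: mult.commute[of 2] power_mult real_sqrt_power[symmetric])
  ultimately show ?thesis
    by simp
qed

text \<open>Only the palindromes of the single odd length \<open>2 * j + 1\<close> are kept. The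
  hypothesis gives \<open>4 * j \<le> 4^j \<le> k^(2j) \<le> n\<close>, so at least half of the
  \<open>n\<close> places remain as end places.\<close>

lemma expected_richness_ge_level:
  assumes k: "k \<ge> 2" and j: "k ^ (2 * j) \<le> n"
  shows "real k ^ Suc j * (real n / 2 / (2 * real k ^ Suc (2 * j) + real n)) \<le> expected_richness n k"
proof -
  have "4 * j \<le> 4 ^ j"
  proof (induction j)
    case (Suc j)
    then show ?case
      by (cases j) auto
  qed simp
  also have "(4::nat) ^ j \<le> k ^ (2 * j)"
    using power_mono[of 2 k "2 * j"] k by (simp add: power_mult)
  finally have jn: "4 * j \<le> n"
    using j by simp
  have n: "n > 0"
    using j k by (metis gr0I le_zero_eq power_not_zero not_numeral_le_zero)
  have "real n / 2 \<le> real (n + 1 - Suc (2 * j))"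
    using jn by simp
  then have "real k ^ Suc j * (real n / 2 / (2 * real k ^ Suc (2 * j) + real n))
      \<le> real k ^ ((Suc (2 * j) + 1) div 2) *
        (real (n + 1 - Suc (2 * j)) / (2 * real k ^ Suc (2 * j) + real n))"
    by (intro mult_mono divide_right_mono) auto
  also have "\<dots> \<le> level_richness k (Suc (2 * j)) n"
    by (rule level_richness_lower) (use k n jn in auto)
  also have "\<dots> \<le> (\<Sum>m\<in>{1..n}. level_richness k m n)"
    by (rule member_le_sum) (use jn n level_richness_nonneg in auto)
  also have "\<dots> = expected_richness n k"
    using k by (simp add: expected_richness_eq)
  finally show ?thesis .
qed

text \<open>With \<open>k^j \<le> sqrt n \<le> k^(j+1)\<close> and \<open>K = k^(2j+1)\<close>, the
  denominator is at most three times the larger of \<open>K\<close> and \<open>n\<close>. This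
  leaves \<open>n / (6 k^j)\<close> or \<open>k^(j+1) / 6\<close>, both at least
  \<open>sqrt n / 6\<close>.\<close>

lemma expected_richness_lower:
  assumes k: "k \<ge> 2"
  shows "sqrt (real n) / 6 \<le> expected_richness n k"
proof (cases "n = 0")
  case False
  then obtain j where j: "real k ^ j \<le> sqrt (real n)" "sqrt (real n) \<le> real k ^ Suc j"
    using ex_power_sqrt_bounds[OF k, of n] by auto
  define K where "K = real k ^ Suc (2 * j)"
  have K: "K > 0" "K = real k ^ Suc j * real k ^ j"
    using k by (auto simp: K_def mult_2 power_add)
  have "(real k ^ j)\<^sup>2 \<le> (sqrt (real n))\<^sup>2"
    using j by (intro power_mono) auto
  then have "real (k ^ (2 * j)) \<le> real n"
    by (simp add: power_mult[symmetric] mult.commute)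
  then have "k ^ (2 * j) \<le> n"
    by (simp only: of_nat_le_iff)
  then have E: "real k ^ Suc j * (real n / 2 / (2 * K + real n)) \<le> expected_richness n k"
    unfolding K_def by (rule expected_richness_ge_level[OF k])
  show ?thesis
  proof (cases "real n \<le> K")
    case True
    have "sqrt (real n) / 6 * (real k ^ j * 6) \<le> sqrt (real n) / 6 * (sqrt (real n) * 6)"
      using j by (intro mult_left_mono) auto
    also have "\<dots> = real n"
      by simp
    finally have "sqrt (real n) / 6 \<le> real n / (real k ^ j * 6)"
      using k by (subst pos_le_divide_eq) auto
    also have "\<dots> = real k ^ Suc j * (real n / 2 / (3 * K))"
      using k by (simp add: K(2))
    also have "\<dots> \<le> real k ^ Suc j * (real n / 2 / (2 * K + real n))"
      using True K(1) by (intro mult_left_mono divide_left_mono) (auto intro!: mult_pos_pos add_pos_nonneg)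
    finally show ?thesis
      using E by linarith
  next
    case F: False
    have "real k ^ Suc j * (real n / 2 / (3 * real n)) \<le> real k ^ Suc j * (real n / 2 / (2 * K + real n))"
      using F K(1) False by (intro mult_left_mono divide_left_mono) (auto intro!: mult_pos_pos add_pos_nonneg)
    moreover have "real k ^ Suc j * (real n / 2 / (3 * real n)) = real k ^ Suc j / 6"
      using False by simp
    ultimately show ?thesis
      using E j(2) by linarith
  qed
next
  case True
  then show ?thesis
    using k by (simp add: expected_richness_eq)
qed

text \<open>Here \<open>n\<close> equals \<open>k\<close> to the length \<open>2 * j + 1\<close> of
  the chosen palindromes, so a constant proportion of the \<open>k^(j+1) = sqrt k * sqrt n\<close>
  palindromes of that length is expected.\<close>

lemma expected_richness_lower_odd_power:
  assumes k: "k \<ge> 2"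
  shows "sqrt (real k) * sqrt (real (k ^ Suc (2 * j))) / 6 \<le> expected_richness (k ^ Suc (2 * j)) k"
proof -
  let ?n = "k ^ Suc (2 * j)"
  have "sqrt (real k) * sqrt (real ?n) = sqrt ((real k ^ Suc j)\<^sup>2)"
    by (simp add: real_sqrt_mult[symmetric] power2_eq_square power_add mult_2 mult_2_right mult_ac
        del: real_sqrt_mult_self real_sqrt_abs2)
  also have "\<dots> = real k ^ Suc j"
    by simp
  finally have "sqrt (real k) * sqrt (real ?n) / 6
      = real k ^ Suc j * (real ?n / 2 / (2 * real k ^ Suc (2 * j) + real ?n))"
    using k by simp
  also have "\<dots> \<le> expected_richness ?n k"
    by (rule expected_richness_ge_level[OF k]) (use k in \<open>auto intro: power_increasing\<close>)
  finally show ?thesis .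
qed

subsection \<open>The limit series\<close>

text \<open>Comparison with the differentiated geometric series of ratio \<open>sqrt r\<close>;
  rounding in \<open>m div 2\<close> costs one factor \<open>1 / sqrt r\<close>. The factor
  \<open>Suc m\<close> is needed for the overlap errors of the generating functions.\<close>

lemma summable_Suc_mult_power_div2:
  fixes r :: real
  assumes r: "0 < r" "r < 1"
  shows "summable (\<lambda>m. real (Suc m) * r ^ (m div 2))"
proof (rule summable_comparison_test')
  have "norm (sqrt r) < 1"
    using r by simp
  then have "summable (\<lambda>m. real (Suc m) * sqrt r ^ m)"
    by (rule geometric_deriv_sums[THEN sums_summable])
  then show "summable (\<lambda>m. (1 / sqrt r) * (real (Suc m) * sqrt r ^ m))"
    by (rule summable_mult)
  fix m :: nat
  have "sqrt r ^ Suc (2 * (m div 2)) \<le> sqrt r ^ m"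
    using r by (intro power_decreasing) auto
  moreover have "sqrt r ^ (2 * (m div 2)) = r ^ (m div 2)"
    using r by (simp add: power_mult)
  ultimately have "sqrt r * r ^ (m div 2) \<le> sqrt r ^ m"
    by simp
  then have "r ^ (m div 2) \<le> (1 / sqrt r) * sqrt r ^ m"
    using r by (simp add: field_simps)
  then have "real (Suc m) * r ^ (m div 2) \<le> real (Suc m) * ((1 / sqrt r) * sqrt r ^ m)"
    by (intro mult_left_mono) auto
  then show "norm (real (Suc m) * r ^ (m div 2)) \<le> (1 / sqrt r) * (real (Suc m) * sqrt r ^ m)"
    using r by (simp add: abs_mult mult_ac)
qed

lemma summable_power_div2:
  fixes r :: real
  assumes r: "0 < r" "r < 1"
  shows "summable (\<lambda>m. r ^ (m div 2))"
  by (rule summable_comparison_test'[OF summable_Suc_mult_power_div2[OF r]])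
    (use r in \<open>auto simp: mult_le_cancel_right1\<close>)

text \<open>The bilateral series \<open>\<Sum>j\<in>\<int>. k^\<lceil>j/2\<rceil> / (1 + z k^j)\<close>: the head is indexed by \<open>j = m + 1 > 0\<close>, the tail by
  \<open>j = - m \<le> 0\<close>.\<close>

definition head_term :: "nat \<Rightarrow> 'a::real_normed_field \<Rightarrow> nat \<Rightarrow> 'a" where
  "head_term k z m = of_nat k ^ Suc (m div 2) / (1 + z * of_nat k ^ Suc m)"

definition tail_term :: "nat \<Rightarrow> 'a::real_normed_field \<Rightarrow> nat \<Rightarrow> 'a" where
  "tail_term k z m = (1 / of_nat k) ^ (m div 2) / (1 + z * (1 / of_nat k) ^ m)"

lemma power_ratio_div2:
  fixes k :: real
  assumes "k \<ge> 1"
  shows "k ^ Suc (m div 2) / k ^ Suc m \<le> (1 / k) ^ (m div 2)"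
proof -
  have "k ^ (m div 2) * k ^ (m div 2) \<le> k ^ m"
    unfolding power_add[symmetric] using assms by (intro power_increasing) auto
  then show ?thesis
    using assms by (simp add: field_simps)
qed

text \<open>Stated over a general normed field, as the same majorant serves real
  \<open>s > 0\<close> and complex arguments.\<close>

lemma norm_head_term_le:
  fixes z :: "'a::real_normed_field"
  assumes k: "k > 0" and e: "e > 0" and le: "e * real k ^ Suc m \<le> norm (1 + z * of_nat k ^ Suc m)"
  shows "norm (head_term k z m) \<le> (1 / e) * (1 / real k) ^ (m div 2)"
proof -
  have pos: "0 < e * real k ^ Suc m"
    using k e by simp
  have "norm (head_term k z m) = real k ^ Suc (m div 2) / norm (1 + z * of_nat k ^ Suc m)"
    by (simp add: head_term_def norm_divide norm_mult norm_power)
  also have "\<dots> \<le> real k ^ Suc (m div 2) / (e * real k ^ Suc m)"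
    using mult_pos_pos[OF less_le_trans[OF pos le] pos] by (intro divide_left_mono le) auto
  also have "\<dots> = (1 / e) * (real k ^ Suc (m div 2) / real k ^ Suc m)"
    by simp
  also have "\<dots> \<le> (1 / e) * (1 / real k) ^ (m div 2)"
    using k e by (intro mult_left_mono power_ratio_div2) auto
  finally show ?thesis .
qed

lemma norm_tail_term_le:
  fixes z :: "'a::real_normed_field"
  assumes k: "k > 0" and e: "e > 0" and le: "e \<le> norm (1 + z * (1 / of_nat k) ^ m)"
  shows "norm (tail_term k z m) \<le> (1 / e) * (1 / real k) ^ (m div 2)"
proof -
  have "norm (tail_term k z m) = (1 / real k) ^ (m div 2) / norm (1 + z * (1 / of_nat k) ^ m)"
    by (simp add: tail_term_def norm_divide norm_mult norm_power)
  also have "\<dots> \<le> (1 / real k) ^ (m div 2) / e"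
    using e less_le_trans[OF e le] by (intro divide_left_mono le mult_pos_pos) auto
  finally show ?thesis
    by simp
qed

lemma summable_head_term:
  fixes s :: real
  assumes k: "k \<ge> 2" and s: "s > 0"
  shows "summable (head_term k s)"
proof (rule summable_comparison_test')
  show "summable (\<lambda>m. (1 / s) * (1 / real k) ^ (m div 2))"
    using k by (intro summable_mult summable_power_div2) auto
  show "norm (head_term k s m) \<le> (1 / s) * (1 / real k) ^ (m div 2)" for m
    using k s by (intro norm_head_term_le) auto
qed

lemma summable_tail_term:
  fixes s :: real
  assumes k: "k \<ge> 2" and s: "s > 0"
  shows "summable (tail_term k s)"
proof (rule summable_comparison_test')
  show "summable (\<lambda>m. (1 / 1) * (1 / real k) ^ (m div 2))"
    using k by (intro summable_mult summable_power_div2) auto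
  show "norm (tail_term k s m) \<le> (1 / 1) * (1 / real k) ^ (m div 2)" for m
    using k s by (intro norm_tail_term_le) auto
qed

text \<open>Dividing \<open>s\<close> by \<open>k^2\<close> shifts the series by two places and
  multiplies it by \<open>k\<close>. A shift by one would not do, since the rounded-up half exponent
  is multiplicative only along even shifts.\<close>

lemma head_sum_scaling:
  fixes s :: real
  assumes k: "k \<ge> 2" and s: "s > 0"
  shows "(\<Sum>m. head_term k (s / real k ^ (2 * M)) m) / real k ^ M
    = (\<Sum>m. head_term k s m) + (\<Sum>m<2 * M. tail_term k s m)"
proof (induction M)
  case (Suc M)
  define u where "u = s / real k ^ (2 * M)"
  have u: "u > 0" "u / (real k)\<^sup>2 > 0"
    using k s by (auto simp: u_def)
  have shift: "head_term k (u / (real k)\<^sup>2) (m + 2) = real k * head_term k u m" for m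
    using k by (simp add: head_term_def power2_eq_square)
  have "(\<Sum>m. head_term k (u / (real k)\<^sup>2) m)
      = (\<Sum>m. head_term k (u / (real k)\<^sup>2) (m + 2)) + (\<Sum>m<2. head_term k (u / (real k)\<^sup>2) m)"
    by (rule suminf_split_initial_segment[OF summable_head_term[OF k u(2)]])
  also have "(\<Sum>m. head_term k (u / (real k)\<^sup>2) (m + 2)) = real k * (\<Sum>m. head_term k u m)"
    unfolding shift by (rule suminf_mult[OF summable_head_term[OF k u(1)]])
  finally have "(\<Sum>m. head_term k (u / (real k)\<^sup>2) m) / real k ^ Suc M
      = (\<Sum>m. head_term k u m) / real k ^ M
        + (\<Sum>m<2. head_term k (u / (real k)\<^sup>2) m) / real k ^ Suc M"
    using k by (simp add: field_simps)
  \<comment> \<open>The two head terms freed by the shift become tail terms in reversed order: index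
    1 gives \<open>2 * M\<close>, index 0 gives \<open>2 * M + 1\<close>.\<close>
  also have "(\<Sum>m<2. head_term k (u / (real k)\<^sup>2) m) / real k ^ Suc M
      = tail_term k s (2 * M) + tail_term k s (Suc (2 * M))"
  proof -
    have "tail_term k s (2 * M) = head_term k (u / (real k)\<^sup>2) 1 / real k ^ Suc M"
      using k by (simp add: tail_term_def head_term_def u_def power2_eq_square power_divide)
    moreover have "tail_term k s (Suc (2 * M)) = head_term k (u / (real k)\<^sup>2) 0 / real k ^ Suc M"
      using k by (simp add: tail_term_def head_term_def u_def power2_eq_square power_divide)
    ultimately show ?thesis
      by (simp add: numeral_2_eq_2 add_divide_distrib)
  qed
  finally show ?case
    using Suc by (simp add: u_def power2_eq_square mult_ac)
qed simp

text \<open>Along \<open>s / k^(2M)\<close> the assumed limit is evaluated through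
  \<open>head_sum_scaling\<close>; the partial tail sums fill up the bilateral series, so the
  asymptotic relation becomes an identity at every \<open>s > 0\<close>.\<close>

lemma scaling_limit_series:
  fixes c :: real
  assumes k: "k \<ge> 2" and s: "s > 0"
    and lim: "((\<lambda>s. sqrt s * (\<Sum>m. head_term k s m)) \<longlongrightarrow> c) (at_right 0)"
  shows "sqrt s * (\<Sum>m. head_term k s m + tail_term k s m) = c"
proof -
  have "filterlim (\<lambda>M. s * ((1 / real k)\<^sup>2) ^ M) (at_right 0) sequentially"
  proof (rule tendsto_imp_filterlim_at_right)
    have "(\<lambda>M. ((1 / real k)\<^sup>2) ^ M) \<longlonglongrightarrow> 0"
      using k by (intro LIMSEQ_power_zero) (simp add: power_less_one_iff abs_square_less_1)
    then show "(\<lambda>M. s * ((1 / real k)\<^sup>2) ^ M) \<longlonglongrightarrow> 0"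
      by (rule tendsto_mult_right_zero)
  qed (use k s in auto)
  moreover have "s * ((1 / real k)\<^sup>2) ^ M = s / real k ^ (2 * M)" for M
    by (simp add: power_mult[symmetric] power_divide)
  ultimately have "filterlim (\<lambda>M. s / real k ^ (2 * M)) (at_right 0) sequentially"
    by simp
  from filterlim_compose[OF lim this]
  have "(\<lambda>M. sqrt (s / real k ^ (2 * M)) * (\<Sum>m. head_term k (s / real k ^ (2 * M)) m)) \<longlonglongrightarrow> c" .
  moreover have "sqrt (s / real k ^ (2 * M)) * (\<Sum>m. head_term k (s / real k ^ (2 * M)) m)
      = sqrt s * ((\<Sum>m. head_term k s m) + (\<Sum>m<2 * M. tail_term k s m))" for M
  proof -
    have "sqrt (real k ^ (2 * M)) = real k ^ M"
      by (simp add: mult.commute[of 2] power_mult real_sqrt_power[symmetric])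
    then show ?thesis
      unfolding head_sum_scaling[OF k s, symmetric] by (simp add: real_sqrt_divide)
  qed
  ultimately have "(\<lambda>M. sqrt s * ((\<Sum>m. head_term k s m) + (\<Sum>m<2 * M. tail_term k s m))) \<longlonglongrightarrow> c"
    by simp
  moreover have "(\<lambda>M. \<Sum>m<2 * M. tail_term k s m) \<longlonglongrightarrow> (\<Sum>m. tail_term k s m)"
    using LIMSEQ_subseq_LIMSEQ[OF summable_LIMSEQ[OF summable_tail_term[OF k s]], of "\<lambda>M. 2 * M"]
    by (simp add: o_def strict_mono_def)
  then have "(\<lambda>M. sqrt s * ((\<Sum>m. head_term k s m) + (\<Sum>m<2 * M. tail_term k s m)))
      \<longlonglongrightarrow> sqrt s * ((\<Sum>m. head_term k s m) + (\<Sum>m. tail_term k s m))"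
    by (intro tendsto_intros)
  ultimately have "c = sqrt s * ((\<Sum>m. head_term k s m) + (\<Sum>m. tail_term k s m))"
    using LIMSEQ_unique by blast
  then show ?thesis
    using suminf_add[OF summable_head_term[OF k s] summable_tail_term[OF k s]] by simp
qed

section \<open>Analytic continuation to the slit plane\<close>

text \<open>\<open>(1 + z0 t) / (1 + t)\<close> lies on the segment from 1 to \<open>z0\<close>,
  which misses 0 because \<open>z0\<close> is off the slit and so stays at a positive distance from
  it. Moving \<open>z0\<close> by less than half that distance costs at most half of the
  bound.\<close>

lemma slit_plane_uniform_bound:
  fixes z0 :: complex
  assumes z0: "z0 \<notin> complex_of_real ` {..0}"
  obtains e where "e > 0"
    "\<And>z t. z \<in> ball z0 e \<Longrightarrow> t \<ge> 0 \<Longrightarrow> e * (1 + t) \<le> norm (1 + z * of_real t)"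
proof -
  have "0 \<notin> closed_segment 1 z0"
  proof
    assume "0 \<in> closed_segment 1 z0"
    then obtain u where u: "0 \<le> u" "u \<le> 1" "0 = (1 - u) *\<^sub>R 1 + u *\<^sub>R z0"
      by (auto simp: closed_segment_def)
    then have "u \<noteq> 0"
      by auto
    then have "z0 = complex_of_real (- ((1 - u) / u))"
      using u(3) by (simp add: scaleR_conv_of_real field_simps)
    moreover have "- ((1 - u) / u) \<le> 0"
      using u by simp
    ultimately show False
      using z0 by blast
  qed
  then obtain e where e: "e > 0" "\<And>x. x \<in> closed_segment 1 z0 \<Longrightarrow> e \<le> dist 0 x"
    using separate_point_closed[of "closed_segment 1 z0" 0] by auto
  show ?thesis
  proof (rule that[of "e / 2"])
    fix z and t :: real assume z: "z \<in> ball z0 (e / 2)" and t: "t \<ge> 0"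
    define u where "u = t / (1 + t)"
    have u: "0 \<le> u" "u \<le> 1" "1 - u = 1 / (1 + t)"
      using t by (auto simp: u_def field_simps)
    have "(1 + z0 * of_real t) / of_real (1 + t) = (1 - u) *\<^sub>R 1 + u *\<^sub>R z0"
      unfolding u(3) unfolding u_def by (simp add: scaleR_conv_of_real add_divide_distrib)
    then have "(1 + z0 * of_real t) / of_real (1 + t) \<in> closed_segment 1 z0"
      using u(1,2) by (auto simp: closed_segment_def)
    then have "e \<le> norm ((1 + z0 * of_real t) / of_real (1 + t))"
      using e(2)[of "(1 + z0 * of_real t) / of_real (1 + t)"] by simp
    also have "\<dots> = norm (1 + z0 * of_real t) / (1 + t)"
      unfolding norm_divide norm_of_real using t by simp
    finally have "e \<le> norm (1 + z0 * of_real t) / (1 + t)" .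
    then have "e * (1 + t) \<le> norm (1 + z0 * of_real t)"
      using t by (simp add: field_simps)
    also have "\<dots> \<le> norm (1 + z * of_real t) + norm ((z0 - z) * of_real t)"
      using norm_triangle_ineq[of "1 + z * of_real t" "(z0 - z) * of_real t"]
      by (simp add: algebra_simps)
    also have "norm ((z0 - z) * of_real t) \<le> e / 2 * t"
      unfolding norm_mult using z t mult_right_mono[of "norm (z0 - z)" "e / 2" t]
      by (simp add: dist_norm)
    finally have *: "e * (1 + t) \<le> norm (1 + z * of_real t) + e / 2 * t"
      by simp
    have "e / 2 * t \<le> e / 2 * (1 + t)"
      using e by simp
    with * show "e / 2 * (1 + t) \<le> norm (1 + z * of_real t)"
      by (simp add: field_simps)
  qed (use e in auto)
qed

text \<open>All poles of the terms lie on the slit, so the sum \<open>g\<close> is holomorphic off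
  it and the identity theorem propagates the relation from the positive reals. Approaching the pole
  at -1 then contradicts it.\<close>

lemma series_not_const_over_sqrt:
  fixes c :: real
  assumes k: "k \<ge> 2"
    and const: "\<And>s. s > 0 \<Longrightarrow> sqrt s * (\<Sum>m. head_term k s m + tail_term k s m) = c"
  shows False
proof -
  define S where "S = - complex_of_real ` {..0}"
  define f where "f m z = head_term k z m + tail_term k z m" for m and z :: complex
  define h where "h m = (1 / real k) ^ (m div 2)" for m
  have h: "summable h"
    unfolding h_def using k by (intro summable_power_div2) auto
  have h0: "h m \<ge> 0" for m
    by (simp add: h_def)
  have openS: "open S"
  proof -
    have "closed (complex_of_real ` {..0})"
      by (intro closed_injective_linear_image) (auto simp: linear_of_real intro: injI)
    then show ?thesis
      unfolding S_def by (rule open_Compl)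
  qed
  have connS: "connected S"
    unfolding S_def by (rule starlike_imp_connected[OF starlike_slotted_complex_plane_left])
  \<comment> \<open>One \<open>e\<close> handles all terms: the uniform bound is taken at
    \<open>t = k^(m+1)\<close> for the head and at \<open>t = k^-m\<close> for the tail, and it also
    keeps the denominators away from 0.\<close>
  have bound: "\<exists>e>0. \<forall>z\<in>ball z0 e. \<forall>m. norm (f m z) \<le> (2 / e) * h m
      \<and> 1 + z * of_nat k ^ Suc m \<noteq> 0 \<and> 1 + z * (1 / of_nat k) ^ m \<noteq> 0" if "z0 \<in> S" for z0
  proof -
    obtain e where e: "e > 0"
      "\<And>z t. z \<in> ball z0 e \<Longrightarrow> t \<ge> 0 \<Longrightarrow> e * (1 + t) \<le> norm (1 + z * complex_of_real t)"
      using slit_plane_uniform_bound[of z0] \<open>z0 \<in> S\<close> unfolding S_def by auto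
    show ?thesis
    proof (intro exI[of _ e] conjI ballI allI)
      fix z m assume z: "z \<in> ball z0 e"
      have 1: "e * (1 + real k ^ Suc m) \<le> norm (1 + z * of_nat k ^ Suc m)"
        using e(2)[OF z, of "real k ^ Suc m"] by simp
      have 2: "e * (1 + (1 / real k) ^ m) \<le> norm (1 + z * (1 / of_nat k) ^ m)"
        using e(2)[OF z, of "(1 / real k) ^ m"] by simp
      have 3: "0 < e * (1 + real k ^ Suc m)" "0 < e * (1 + (1 / real k) ^ m)"
        using e(1) k by (auto intro!: mult_pos_pos add_pos_nonneg)
      show "1 + z * of_nat k ^ Suc m \<noteq> 0"
        using 1 3 by force
      show "1 + z * (1 / of_nat k) ^ m \<noteq> 0"
        using 2 3 by force
      have "norm (head_term k z m) \<le> (1 / e) * (1 / real k) ^ (m div 2)"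
        using k e(1) by (intro norm_head_term_le order_trans[OF _ 1]) auto
      moreover have "norm (tail_term k z m) \<le> (1 / e) * (1 / real k) ^ (m div 2)"
        using k e(1) by (intro norm_tail_term_le order_trans[OF _ 2]) auto
      ultimately show "norm (f m z) \<le> (2 / e) * h m"
        unfolding f_def h_def using norm_triangle_ineq[of "head_term k z m" "tail_term k z m"] by simp
    qed (fact e(1))
  qed
  obtain g where g: "\<And>z. z \<in> S \<Longrightarrow> (\<lambda>m. f m z) sums g z"
    "\<And>z. z \<in> S \<Longrightarrow> g field_differentiable (at z)"
  proof (rule series_differentiable_comparison_complex[OF openS, of f])
    fix m z assume "z \<in> S"
    then have ne: "1 + z * of_nat k ^ Suc m \<noteq> 0" "1 + z * (1 / of_nat k) ^ m \<noteq> 0"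
      using bound[of z] by force+
    have "(\<lambda>z. of_nat k ^ Suc (m div 2) / (1 + z * of_nat k ^ Suc m)
        + (1 / of_nat k) ^ (m div 2) / (1 + z * (1 / of_nat k) ^ m)) field_differentiable (at z)"
      using ne by (intro derivative_intros field_differentiable_add field_differentiable_divide
          field_differentiable_mult field_differentiable_const field_differentiable_ident)
    then show "f m field_differentiable (at z)"
      by (simp add: f_def[abs_def] head_term_def tail_term_def)
  next
    fix z assume "z \<in> S"
    then obtain e where e: "e > 0" "\<And>y m. y \<in> ball z e \<Longrightarrow> norm (f m y) \<le> (2 / e) * h m"
      using bound[of z] by blast
    show "\<exists>d H. 0 < d \<and> summable H \<and> range H \<subseteq> \<real>\<^sub>\<ge>\<^sub>0
        \<and> (\<forall>\<^sub>F n in sequentially. \<forall>y\<in>ball z d \<inter> S. cmod (f n y) \<le> cmod (H n))"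
    proof (intro exI conjI always_eventually allI ballI)
      show "0 < e"
        by (fact e(1))
      show "summable (\<lambda>m. complex_of_real ((2 / e) * h m))"
        unfolding summable_of_real_iff by (intro summable_mult h)
      show "range (\<lambda>m. complex_of_real ((2 / e) * h m)) \<subseteq> \<real>\<^sub>\<ge>\<^sub>0"
        using e(1) h0 by auto
      fix n y assume "y \<in> ball z e \<inter> S"
      then have "norm (f n y) \<le> (2 / e) * h n"
        using e(2) by blast
      also have "\<dots> = cmod (complex_of_real ((2 / e) * h n))"
        using e(1) h0[of n] by (simp only: norm_of_real abs_of_nonneg mult_nonneg_nonneg divide_nonneg_pos)
      finally show "cmod (f n y) \<le> cmod (complex_of_real ((2 / e) * h n))" .
    qed
  qed (use that in blast)
  have hol: "g holomorphic_on S"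
    using g(2) openS by (auto simp: holomorphic_on_open field_differentiable_def)
  \<comment> \<open>Squaring the relation avoids choosing a branch of the complex square
    root.\<close>
  have F: "(g z)\<^sup>2 * z = of_real (c\<^sup>2)" if z: "z \<in> S" for z
  proof -
    have on_reals: "(g (of_real s))\<^sup>2 * of_real s = of_real (c\<^sup>2)" if s: "s > 0" for s
    proof -
      have inS: "complex_of_real s \<in> S"
        using s by (auto simp: S_def)
      have "summable (\<lambda>m. head_term k s m + tail_term k s m)"
        using summable_add[OF summable_head_term[OF k s] summable_tail_term[OF k s]] .
      then have "(\<lambda>m. complex_of_real (head_term k s m + tail_term k s m)) sums
          of_real (\<Sum>m. head_term k s m + tail_term k s m)"
        by (intro sums_of_real summable_sums)
      moreover have "complex_of_real (head_term k s m + tail_term k s m) = f m (of_real s)" for m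
        by (simp add: f_def head_term_def tail_term_def)
      ultimately have "g (of_real s) = of_real (\<Sum>m. head_term k s m + tail_term k s m)"
        using g(1)[OF inS] by (simp add: sums_unique2)
      then have "(g (of_real s))\<^sup>2 * of_real s
          = of_real ((sqrt s * (\<Sum>m. head_term k s m + tail_term k s m))\<^sup>2)"
        using s by (simp add: power_mult_distrib mult.commute flip: of_real_power)
      then show ?thesis
        using const[OF s] by simp
    qed
    have "(\<lambda>z. (g z)\<^sup>2 * z) constant_on S"
    proof (rule analytic_continuation'[OF _ openS connS, of _ "of_real ` {0<..}" 1])
      show "(\<lambda>z. (g z)\<^sup>2 * z) holomorphic_on S"
        using hol by (intro holomorphic_intros)
      show "complex_of_real ` {0<..} \<subseteq> S" "1 \<in> S"
        by (auto simp: S_def complex_eq_iff)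
      show "(\<lambda>z. (g z)\<^sup>2 * z) constant_on of_real ` {0<..}"
        unfolding constant_on_def using on_reals by auto
      show "1 islimpt complex_of_real ` {0<..}"
        unfolding islimpt_approachable
      proof (intro allI impI)
        fix e :: real assume "e > 0"
        have "complex_of_real (1 + e / 2) \<noteq> of_real 1"
          unfolding of_real_eq_iff using \<open>e > 0\<close> by simp
        moreover have "dist (complex_of_real (1 + e / 2)) (of_real 1) < e"
          unfolding dist_of_real using \<open>e > 0\<close> by (simp add: dist_norm)
        ultimately show "\<exists>x'\<in>complex_of_real ` {0<..}. x' \<noteq> 1 \<and> dist x' 1 < e"
          using \<open>e > 0\<close> by (intro bexI[of _ "complex_of_real (1 + e / 2)"] imageI) auto
      qed
    qed
    then obtain C where C: "\<And>z. z \<in> S \<Longrightarrow> (g z)\<^sup>2 * z = C"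
      by (auto simp: constant_on_def)
    have "1 \<in> S"
      by (auto simp: S_def complex_eq_iff)
    then show ?thesis
      using C[OF z] C[of 1] on_reals[of 1] by simp
  qed
  \<comment> \<open>Near \<open>- 1\<close> only the term \<open>1 / (1 + z)\<close> is unbounded.\<close>
  define B where "B = (\<Sum>m. 4 * h m)"
  have B0: "B \<ge> 0"
    unfolding B_def by (intro suminf_nonneg summable_mult h) (simp add: h0)
  \<comment> \<open>Chosen so that \<open>1 / \<epsilon> - B = \<bar>c\<bar> + 1\<close>, which
    exceeds the bound \<open>\<bar>c\<bar>\<close> that \<open>F\<close> imposes on
    \<open>norm (g z)\<close>.\<close>
  define \<epsilon> where "\<epsilon> = 1 / (B + \<bar>c\<bar> + 1)"
  define z where "z = Complex (- 1) \<epsilon>"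
  have eps: "\<epsilon> > 0"
    using B0 by (simp add: \<epsilon>_def)
  have zS: "z \<in> S"
    using eps by (auto simp: S_def z_def complex_eq_iff)
  \<comment> \<open>\<open>z\<close> has real part -1, so \<open>1 + z t\<close> has real part
    \<open>1 - t\<close>. For \<open>t \<ge> 2\<close> this is at least \<open>t / 2\<close> in
    modulus and for \<open>0 \<le> t \<le> 1/2\<close> at least 1/2, which gives the factor 2 for
    each term other than \<open>tail_term k z 0\<close>.\<close>
  have ge: "\<bar>1 - t\<bar> \<le> norm (1 + z * of_real t)" for t
    using abs_Re_le_cmod[of "1 + z * of_real t"] by (simp add: z_def)
  have tail0: "tail_term k z 0 = 1 / (1 + z)"
    by (simp add: tail_term_def)
  have "norm (f m z - (if m = 0 then 1 / (1 + z) else 0)) \<le> 4 * h m" for m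
  proof -
    have kp: "real k ^ Suc m \<ge> 2"
      using k mult_mono[of 2 "real k" 1 "real k ^ m"] by simp
    then have "1 / 2 * real k ^ Suc m \<le> \<bar>1 - real k ^ Suc m\<bar>"
      by linarith
    also have "\<dots> \<le> norm (1 + z * of_nat k ^ Suc m)"
      using ge[of "real k ^ Suc m"] by simp
    finally have "norm (head_term k z m) \<le> 1 / (1 / 2) * (1 / real k) ^ (m div 2)"
      using k by (intro norm_head_term_le) auto
    then have hd: "norm (head_term k z m) \<le> 2 * h m"
      by (simp add: h_def)
    show ?thesis
    proof (cases "m = 0")
      case True
      have "h m \<ge> 0"
        by (rule h0)
      with True hd show ?thesis
        by (simp add: f_def tail0)
    next
      case False
      then obtain i where i: "m = Suc i"
        by (cases m) auto
      have "(1 / real k) ^ m \<le> (1 / 2) ^ m"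
        using k by (intro power_mono) (auto simp: field_simps)
      also have "\<dots> \<le> 1 / 2"
        unfolding i by (simp add: power_le_one)
      finally have "1 / 2 \<le> \<bar>1 - (1 / real k) ^ m\<bar>"
        by linarith
      also have "\<dots> \<le> norm (1 + z * (1 / of_nat k) ^ m)"
        using ge[of "(1 / real k) ^ m"] by simp
      finally have "norm (tail_term k z m) \<le> 1 / (1 / 2) * (1 / real k) ^ (m div 2)"
        using k by (intro norm_tail_term_le) auto
      then have "norm (tail_term k z m) \<le> 2 * h m"
        by (simp add: h_def)
      then show ?thesis
        using hd norm_triangle_ineq[of "head_term k z m" "tail_term k z m"] False
        by (simp add: f_def)
    qed
  qed
  moreover have "(\<lambda>m. f m z - (if m = 0 then 1 / (1 + z) else 0)) sums (g z - 1 / (1 + z))"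
    using sums_diff[OF g(1)[OF zS] sums_single[of 0 "\<lambda>_. 1 / (1 + z)"]] by simp
  moreover have "(\<lambda>m. 4 * h m) sums B"
    unfolding B_def by (intro summable_sums summable_mult h)
  ultimately have "norm (g z - 1 / (1 + z)) \<le> B"
    by (meson norm_sums_le)
  moreover have "norm (1 / (1 + z)) = 1 / \<epsilon>"
    using eps unfolding norm_divide by (simp add: z_def cmod_def)
  ultimately have low: "1 / \<epsilon> - B \<le> norm (g z)"
    using norm_triangle_ineq2[of "1 / (1 + z)" "g z"] by (simp add: norm_minus_commute)
  have "(norm (g z))\<^sup>2 * norm z = c\<^sup>2"
    using arg_cong[OF F[OF zS], of norm] by (simp add: norm_mult norm_power)
  moreover have "1 \<le> norm z"
    using abs_Re_le_cmod[of z] by (simp add: z_def)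
  ultimately have "(norm (g z))\<^sup>2 \<le> c\<^sup>2"
    using mult_left_mono[of 1 "norm z" "(norm (g z))\<^sup>2"] by simp
  then have "norm (g z) \<le> \<bar>c\<bar>"
    by (simp add: abs_le_square_iff[symmetric])
  then show False
    using low B0 by (simp add: \<epsilon>_def)
qed

subsection \<open>An Abelian theorem\<close>

text \<open>The binomial series of exponent -3/2 at \<open>s - 1\<close>, with the signs absorbed.
  Its coefficients are positive and grow like \<open>sqrt n\<close>, which makes it the comparison
  series for \<open>abel_sqrt\<close>.\<close>

lemma three_halves_series:
  fixes s :: real
  assumes s: "0 < s" "s < 1"
  shows "(\<lambda>n. pochhammer (3 / 2) n / fact n * (1 - s) ^ n) sums (s powr (- (3 / 2)))"
proof -
  have "((- (3 / 2)) gchoose n) * (s - 1) ^ n = pochhammer (3 / 2) n / fact n * (1 - s) ^ n" for n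
  proof -
    have "(s - 1) ^ n = (- 1) ^ n * (1 - s) ^ n"
      unfolding power_mult_distrib[symmetric] by simp
    then show ?thesis
      by (simp add: gbinomial_pochhammer)
  qed
  then show ?thesis
    using gen_binomial_real[of "s - 1" "- (3 / 2)"] s by simp
qed

lemma three_halves_coeff_asymp:
  "(\<lambda>n. pochhammer (3 / 2) n / fact n / sqrt (real n)) \<longlonglongrightarrow> 1 / Gamma (3 / 2 :: real)"
proof -
  have "(\<lambda>n. ((- (3 / 2) :: real) gchoose n) / ((- 1) ^ n / exp ((- (3 / 2) + 1) * of_real (ln (real n)))))
      \<longlonglongrightarrow> inverse (Gamma (- (- (3 / 2))))"
    by (rule gbinomial_asymptotic)
  moreover have "\<forall>\<^sub>F n in sequentially.
      ((- (3 / 2) :: real) gchoose n) / ((- 1) ^ n / exp ((- (3 / 2) + 1) * of_real (ln (real n))))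
      = pochhammer (3 / 2) n / fact n / sqrt (real n)"
    using eventually_gt_at_top[of 0]
  proof eventually_elim
    case (elim n)
    have "exp ((- (3 / 2) + 1) * of_real (ln (real n))) = real n powr (- (1 / 2))"
      using elim by (simp add: powr_def)
    also have "\<dots> = 1 / sqrt (real n)"
      using elim by (simp add: powr_minus_divide powr_half_sqrt)
    finally show ?case
      by (simp add: gbinomial_pochhammer)
  qed
  ultimately show ?thesis
    by (simp add: tendsto_cong inverse_eq_divide)
qed

text \<open>Compare \<open>a\<close> with the coefficients \<open>b\<close>, whose series is exactly
  \<open>s powr (-3/2)\<close>: \<open>a n / b n\<close> converges, so \<open>a - C b\<close> is at
  most \<open>e/2 * b\<close> up to finitely many terms, and these vanish after multiplication by
  \<open>s powr (3/2)\<close>.\<close>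

lemma abel_sqrt:
  fixes a :: "nat \<Rightarrow> real"
  assumes a: "(\<lambda>n. a n / sqrt (real n)) \<longlonglongrightarrow> c"
  shows "((\<lambda>s. s powr (3 / 2) * (\<Sum>n. a n * (1 - s) ^ n)) \<longlongrightarrow> c * Gamma (3 / 2)) (at_right 0)"
proof -
  define b :: "nat \<Rightarrow> real" where "b n = pochhammer (3 / 2) n / fact n" for n
  define C where "C = c * Gamma (3 / 2)"
  have b0: "b n > 0" for n
    by (simp add: b_def pochhammer_pos)
  have "Gamma (3 / 2 :: real) > 0"
    by (rule Gamma_real_pos) simp
  then have nz: "1 / Gamma (3 / 2 :: real) \<noteq> 0"
    by (metis divide_eq_0_iff less_irrefl zero_neq_one)
  have "(\<lambda>n. (a n / sqrt (real n)) / (b n / sqrt (real n))) \<longlonglongrightarrow> c / (1 / Gamma (3 / 2))"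
    unfolding b_def by (rule tendsto_divide[OF a three_halves_coeff_asymp nz])
  then have "(\<lambda>n. (a n / sqrt (real n)) / (b n / sqrt (real n))) \<longlonglongrightarrow> C"
    by (simp only: C_def divide_divide_eq_right mult_1_right div_by_1)
  \<comment> \<open>At \<open>n = 0\<close> division by \<open>sqrt 0\<close> yields 0, so the
    cancellation is claimed only for \<open>n > 0\<close>.\<close>
  moreover have "\<forall>\<^sub>F n in sequentially. (a n / sqrt (real n)) / (b n / sqrt (real n)) = a n / b n"
    using eventually_gt_at_top[of 0] by eventually_elim simp
  ultimately have ab: "(\<lambda>n. a n / b n) \<longlonglongrightarrow> C"
    by (rule Lim_transform_eventually)
  show ?thesis
    unfolding C_def[symmetric]
  proof (rule tendstoI)
    fix e :: real assume e: "e > 0"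
    then obtain N where N: "\<And>n. n \<ge> N \<Longrightarrow> \<bar>a n / b n - C\<bar> < e / 2"
      using ab[THEN LIMSEQ_D, of "e / 2"] by auto
    \<comment> \<open>\<open>d\<close> absorbs the first \<open>N\<close> coefficients, so that the
      estimate \<open>ad\<close> holds for every \<open>n\<close>.\<close>
    define d where "d n = (if n < N then \<bar>a n - C * b n\<bar> else 0)" for n
    define K where "K = (\<Sum>n<N. d n)"
    have d0: "d n \<ge> 0" for n
      by (simp add: d_def)
    have ad: "\<bar>a n - C * b n\<bar> \<le> e / 2 * b n + d n" for n
    proof (cases "n < N")
      case True
      then show ?thesis
        using b0[of n] e by (simp add: d_def)
    next
      case False
      have "\<bar>a n - C * b n\<bar> = \<bar>a n / b n - C\<bar> * b n"
        using b0[of n] by (simp add: abs_mult[symmetric] abs_of_pos[symmetric] field_simps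
            del: abs_of_pos abs_mult_pos)
      also have "\<dots> \<le> e / 2 * b n"
        using N[of n] False b0[of n] by (intro mult_right_mono) auto
      finally show ?thesis
        using d0[of n] by simp
    qed
    have main: "\<bar>s powr (3 / 2) * (\<Sum>n. a n * (1 - s) ^ n) - C\<bar> \<le> e / 2 + K * s powr (3 / 2)"
      if s: "0 < s" "s < 1" for s
    proof -
      define u v X where "u = s powr (3 / 2)" and "v = s powr (- (3 / 2))"
        and "X = (\<Sum>n. a n * (1 - s) ^ n)"
      have bs: "(\<lambda>n. b n * (1 - s) ^ n) sums (s powr (- (3 / 2)))"
        using three_halves_series[OF s] by (simp add: b_def)
      have "(\<lambda>n. if n < N then d n * (1 - s) ^ n else 0) sums (\<Sum>n<N. d n * (1 - s) ^ n)"
        using sums_If_finite_set[of "{..<N}" "\<lambda>n. d n * (1 - s) ^ n"] by simp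
      then have ds: "(\<lambda>n. d n * (1 - s) ^ n) sums (\<Sum>n<N. d n * (1 - s) ^ n)"
        by (rule sums_cong[THEN iffD1, rotated]) (simp add: d_def)
      have dK: "(\<Sum>n<N. d n * (1 - s) ^ n) \<le> K"
        unfolding K_def using s d0 by (intro sum_mono mult_left_le) (auto intro: power_le_one)
      have maj: "(\<lambda>n. e / 2 * (b n * (1 - s) ^ n) + d n * (1 - s) ^ n)
          sums (e / 2 * s powr (- (3 / 2)) + (\<Sum>n<N. d n * (1 - s) ^ n))"
        by (intro sums_add sums_mult bs ds)
      have le: "norm (a n * (1 - s) ^ n - C * (b n * (1 - s) ^ n))
          \<le> e / 2 * (b n * (1 - s) ^ n) + d n * (1 - s) ^ n" for n
      proof -
        have "a n * (1 - s) ^ n - C * (b n * (1 - s) ^ n) = (a n - C * b n) * (1 - s) ^ n"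
          by (simp add: algebra_simps)
        then have "norm (a n * (1 - s) ^ n - C * (b n * (1 - s) ^ n)) = \<bar>a n - C * b n\<bar> * (1 - s) ^ n"
          using s by (simp add: abs_mult)
        also have "\<dots> \<le> (e / 2 * b n + d n) * (1 - s) ^ n"
          using s by (intro mult_right_mono ad) auto
        finally show ?thesis
          by (simp add: algebra_simps)
      qed
      \<comment> \<open>The convergence of the series of \<open>a\<close> is not presupposed: the
        difference is dominated by \<open>maj\<close>, and adding the series of \<open>b\<close>
        back recovers it.\<close>
      have "summable (\<lambda>n. a n * (1 - s) ^ n - C * (b n * (1 - s) ^ n))"
        by (rule summable_comparison_test'[OF sums_summable[OF maj]]) (rule le)
      then have diff: "(\<lambda>n. a n * (1 - s) ^ n - C * (b n * (1 - s) ^ n))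
          sums (\<Sum>n. a n * (1 - s) ^ n - C * (b n * (1 - s) ^ n))"
        by (rule summable_sums)
      from sums_add[OF this sums_mult[OF bs, of C]]
      have "(\<Sum>n. a n * (1 - s) ^ n - C * (b n * (1 - s) ^ n))
          = (\<Sum>n. a n * (1 - s) ^ n) - C * s powr (- (3 / 2))"
        by (simp add: sums_iff)
      then have bd: "\<bar>X - C * v\<bar> \<le> e / 2 * v + K"
        using norm_sums_le[OF diff maj le] dK by (simp add: X_def v_def)
      have uv: "u > 0" "u * v = 1"
        using s by (simp_all add: u_def v_def flip: powr_add)
      have "\<bar>u * X - C\<bar> = \<bar>u * X - C * (u * v)\<bar>"
        using uv by simp
      also have "u * X - C * (u * v) = u * (X - C * v)"
        by (simp add: algebra_simps)
      also have "\<bar>u * (X - C * v)\<bar> = u * \<bar>X - C * v\<bar>"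
        using uv by (simp add: abs_mult)
      also have "\<dots> \<le> u * (e / 2 * v + K)"
        using uv by (intro mult_left_mono[OF bd]) simp
      also have "\<dots> = e / 2 * (u * v) + K * u"
        by (simp add: algebra_simps)
      finally show ?thesis
        using uv by (simp add: u_def X_def)
    qed
    have "((\<lambda>s. K * s powr (3 / 2)) \<longlongrightarrow> 0) (at_right 0)"
      by real_asymp
    then have "\<forall>\<^sub>F s in at_right 0. K * s powr (3 / 2) < e / 2"
      using e by (intro order_tendstoD(2)[of _ 0]) auto
    moreover have "\<forall>\<^sub>F s in at_right (0::real). 0 < s \<and> s < 1"
      by (auto simp: eventually_at_right_field intro: exI[of _ 1])
    ultimately show "\<forall>\<^sub>F s in at_right 0. dist (s powr (3 / 2) * (\<Sum>n. a n * (1 - s) ^ n)) C < e"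
    proof eventually_elim
      case (elim s)
      then show ?case
        using main[of s] by (simp add: dist_real_def)
    qed
  qed
qed

subsection \<open>Generating functions\<close>

definition first_gf :: "nat \<Rightarrow> nat list \<Rightarrow> real \<Rightarrow> real" where
  "first_gf k p z = (\<Sum>t. first_prob k p t * z ^ t)"

text \<open>For a word over the alphabet this is the autocorrelation polynomial of \<open>p\<close>
  evaluated at \<open>z / k\<close>.\<close>

definition overlap_gf :: "nat \<Rightarrow> nat list \<Rightarrow> real \<Rightarrow> real" where
  "overlap_gf k p z = (\<Sum>d<length p. return_prob k p d * z ^ d)"

text \<open>\<open>full_gf\<close> is the generating function of all occurrences of a word of length \<open>m\<close>, not only the
  first; it does not depend on the word.\<close>

definition full_gf :: "nat \<Rightarrow> nat \<Rightarrow> real \<Rightarrow> real" where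
  "full_gf k m z = z ^ m / real k ^ m / (1 - z)"

lemma full_gf_sums:
  assumes z: "0 < z" "z < 1"
  shows "(\<lambda>i. z ^ (i + m) / real k ^ m) sums full_gf k m z"
  using sums_mult[OF geometric_sums[of z], of "z ^ m / real k ^ m"] z
  by (simp add: full_gf_def power_add mult_ac)

lemma first_gf_sums:
  assumes k: "k \<ge> 2" and p: "p \<in> words m k" and m: "m > 0" and z: "0 < z" "z < 1"
  shows "(\<lambda>t. first_prob k p t * z ^ t) sums first_gf k p z"
proof -
  have "first_prob k p t \<le> 1" for t
    using first_prob_le[of k p m t] p m k by (auto intro: order_trans)
  then have "summable (\<lambda>t. first_prob k p t * z ^ t)"
    using z first_prob_nonneg[of k p]
    by (intro summable_comparison_test'[OF summable_geometric[of z]])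
      (auto simp: abs_mult mult_left_le_one_le)
  then show ?thesis
    unfolding first_gf_def by (rule summable_sums)
qed

lemma return_gf_sums:
  assumes k: "k \<ge> 2" and p: "p \<in> words m k" and z: "0 < z" "z < 1"
  shows "(\<lambda>d. return_prob k p d * z ^ d) sums (overlap_gf k p z + full_gf k m z)"
proof -
  have len: "length p = m"
    using p by (simp add: words_def)
  have "return_prob k p (i + m) * z ^ (i + m) = z ^ (i + m) / real k ^ m" for i
    using return_prob_ge_length[OF p, of "i + m"] k by simp
  then have "(\<lambda>i. return_prob k p (i + m) * z ^ (i + m)) sums full_gf k m z"
    using full_gf_sums[OF z] by simp
  then show ?thesis
    using sums_iff_shift[of "\<lambda>d. return_prob k p d * z ^ d" m "full_gf k m z"]
    by (simp add: overlap_gf_def len add.commute)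
qed

text \<open>The renewal equation as a Cauchy product: its coefficients vanish below
  \<open>m\<close>, where no occurrence fits, and equal \<open>k^-m\<close> from there on.\<close>

lemma first_gf_eq:
  assumes k: "k \<ge> 2" and p: "p \<in> words m k" and m: "m > 0" and z: "0 < z" "z < 1"
  shows "first_gf k p z * (overlap_gf k p z + full_gf k m z) = full_gf k m z"
proof -
  let ?f = "\<lambda>t. first_prob k p t * z ^ t" and ?r = "\<lambda>d. return_prob k p d * z ^ d"
  have f: "?f sums first_gf k p z"
    by (rule first_gf_sums[OF k p m z])
  have r: "?r sums (overlap_gf k p z + full_gf k m z)"
    by (rule return_gf_sums[OF k p z])
  have "(\<lambda>n. \<Sum>i\<le>n. ?f i * ?r (n - i)) sums ((\<Sum>n. ?f n) * (\<Sum>n. ?r n))"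
  proof (rule Cauchy_product_sums)
    show "summable (\<lambda>n. norm (?f n))"
      using f z first_prob_nonneg[of k p] by (simp add: sums_iff)
    show "summable (\<lambda>n. norm (?r n))"
      using r z return_prob_nonneg[of k p] by (simp add: sums_iff)
  qed
  moreover have "(\<Sum>i\<le>n. ?f i * ?r (n - i))
      = (\<Sum>i\<le>n. first_prob k p i * return_prob k p (n - i)) * z ^ n" for n
    unfolding sum_distrib_right by (rule sum.cong) (auto simp flip: power_add)
  ultimately have
    S: "(\<lambda>n. (\<Sum>i\<le>n. first_prob k p i * return_prob k p (n - i)) * z ^ n)
      sums (first_gf k p z * (overlap_gf k p z + full_gf k m z))"
    using f r by (simp add: sums_iff)
  have "(\<Sum>n<m. (\<Sum>i\<le>n. first_prob k p i * return_prob k p (n - i)) * z ^ n) = 0"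
    using first_prob_eq_0[OF p] by (intro sum.neutral ballI) simp
  then have "(\<lambda>n. (\<Sum>i\<le>n + m. first_prob k p i * return_prob k p (n + m - i)) * z ^ (n + m))
      sums (first_gf k p z * (overlap_gf k p z + full_gf k m z))"
    using S by (subst sums_iff_shift) simp
  then have "(\<lambda>n. z ^ (n + m) / real k ^ m)
      sums (first_gf k p z * (overlap_gf k p z + full_gf k m z))"
    using renewal_equation[OF _ p m] k by simp
  then show ?thesis
    using full_gf_sums[OF z] sums_unique2 by blast
qed

lemma occ_gf_sums:
  assumes k: "k \<ge> 2" and p: "p \<in> words m k" and m: "m > 0" and z: "0 < z" "z < 1"
  shows "(\<lambda>n. occ_prob k p n * z ^ n) sums (first_gf k p z / (1 - z))"
proof -
  let ?f = "\<lambda>t. first_prob k p t * z ^ t"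
  have ne: "p \<noteq> []"
    using p m by (auto simp: words_def)
  have f: "?f sums first_gf k p z"
    by (rule first_gf_sums[OF k p m z])
  have "(\<lambda>n. \<Sum>i\<le>n. ?f i * z ^ (n - i)) sums ((\<Sum>n. ?f n) * (\<Sum>n. z ^ n))"
  proof (rule Cauchy_product_sums)
    show "summable (\<lambda>n. norm (?f n))"
      using f z first_prob_nonneg[of k p] by (simp add: sums_iff)
    show "summable (\<lambda>n. norm (z ^ n))"
      using z by simp
  qed
  moreover have "(\<Sum>i\<le>n. ?f i * z ^ (n - i)) = occ_prob k p n * z ^ n" for n
    unfolding occ_prob_eq_sum[OF _ ne] sum_distrib_right using k occ_prob_eq_sum[OF _ ne]
    by (auto simp: sum_distrib_right simp flip: power_add intro!: sum.cong)
  ultimately show ?thesis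
    using f z by (simp add: sums_iff suminf_geometric)
qed

lemma overlap_gf_bounds:
  assumes k: "k \<ge> 2" and p: "p \<in> words m k" and m: "m > 0" and z: "0 < z" "z < 1"
  shows "1 \<le> overlap_gf k p z" "overlap_gf k p z \<le> 1 + (\<Sum>d\<in>{1..<m}. return_prob k p d)"
proof -
  have "{..<m} = insert 0 {1..<m}"
    using m by auto
  then have eq: "overlap_gf k p z = 1 + (\<Sum>d\<in>{1..<m}. return_prob k p d * z ^ d)"
    using p by (simp add: overlap_gf_def words_def)
  show "1 \<le> overlap_gf k p z"
    unfolding eq using z return_prob_nonneg[of k p] by (auto intro!: sum_nonneg)
  show "overlap_gf k p z \<le> 1 + (\<Sum>d\<in>{1..<m}. return_prob k p d)"
    unfolding eq using z return_prob_nonneg[of k p]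
    by (auto intro!: sum_mono mult_left_le power_le_one)
qed

text \<open>Solving for the first occurrence gives \<open>x / (C + x)\<close> with
  \<open>C \<ge> 1\<close> the overlap polynomial. The lower bound is linear in the overlaps, hence
  can be summed over many words.\<close>

lemma first_gf_bounds:
  assumes k: "k \<ge> 2" and p: "p \<in> words m k" and m: "m > 0" and z: "0 < z" "z < 1"
  defines "x \<equiv> full_gf k m z"
  shows "first_gf k p z \<le> x / (1 + x)"
    "x / (1 + x) * (1 - (\<Sum>d\<in>{1..<m}. return_prob k p d)) \<le> first_gf k p z"
proof -
  define C where "C = overlap_gf k p z"
  have C: "1 \<le> C" "C - 1 \<le> (\<Sum>d\<in>{1..<m}. return_prob k p d)"
    using overlap_gf_bounds[OF k p m z] by (simp_all add: C_def)
  have x: "x > 0"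
    using z k by (simp add: x_def full_gf_def)
  have F: "first_gf k p z = x / (C + x)"
    using first_gf_eq[OF k p m z] C x by (simp add: C_def x_def field_simps)
  show "first_gf k p z \<le> x / (1 + x)"
    unfolding F using C x by (intro divide_left_mono) auto
  have "x / (1 + x) * (1 - (\<Sum>d\<in>{1..<m}. return_prob k p d)) \<le> x / (1 + x) * (1 - (C - 1))"
    using C x by (intro mult_left_mono) auto
  also have "\<dots> \<le> x / (C + x)"
  proof -
    have "(2 - C) * (C + x) \<le> 1 + x"
    proof -
      have "(1 + x) - (2 - C) * (C + x) = (C - 1) * (C - 1 + x)"
        by (simp add: algebra_simps)
      also have "\<dots> \<ge> 0"
        using C x by simp
      finally show ?thesis
        by simp
    qed
    then have "(2 - C) / (1 + x) \<le> 1 / (C + x)"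
      using C x by (simp add: field_simps)
    then have "x * ((2 - C) / (1 + x)) \<le> x * (1 / (C + x))"
      using x by (intro mult_left_mono) auto
    then show ?thesis
      by simp
  qed
  finally show "x / (1 + x) * (1 - (\<Sum>d\<in>{1..<m}. return_prob k p d)) \<le> first_gf k p z"
    unfolding F .
qed

definition level_gf :: "nat \<Rightarrow> nat \<Rightarrow> real \<Rightarrow> real" where
  "level_gf k m z = (\<Sum>p\<in>palindromes m k. first_gf k p z)"

lemma level_gf_sums:
  assumes k: "k \<ge> 2" and m: "m > 0" and z: "0 < z" "z < 1"
  shows "(\<lambda>n. level_richness k m n * z ^ n) sums (level_gf k m z / (1 - z))"
  unfolding level_richness_def level_gf_def sum_distrib_right sum_divide_distrib
  by (rule sums_sum) (use occ_gf_sums[OF k _ m z] in \<open>auto simp: palindromes_def\<close>)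

text \<open>By \<open>sum_card_extensions_le\<close> each shift \<open>d\<close> contributes at most
  1 to the overlaps summed over all palindromes. The error is thus of size \<open>m\<close>, against
  the \<open>k^((m+1) div 2)\<close> palindromes of the main term.\<close>

lemma level_gf_approx:
  assumes k: "k \<ge> 2" and m: "m > 0" and z: "0 < z" "z < 1"
  defines "x \<equiv> full_gf k m z"
  shows "\<bar>level_gf k m z - real k ^ ((m + 1) div 2) * (x / (1 + x))\<bar> \<le> real m * (x / (1 + x))"
proof -
  have x: "x > 0"
    using z k by (simp add: x_def full_gf_def)
  have card: "(\<Sum>p\<in>palindromes m k. x / (1 + x)) = real k ^ ((m + 1) div 2) * (x / (1 + x))"
    by (simp add: card_palindromes[OF m])
  have upper: "level_gf k m z \<le> real k ^ ((m + 1) div 2) * (x / (1 + x))"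
    unfolding level_gf_def card[symmetric]
    by (rule sum_mono) (use first_gf_bounds(1)[OF k _ m z] in \<open>auto simp: palindromes_def x_def\<close>)
  have "(\<Sum>p\<in>palindromes m k. x / (1 + x) * (1 - (\<Sum>d\<in>{1..<m}. return_prob k p d))) \<le> level_gf k m z"
    unfolding level_gf_def
    by (rule sum_mono) (use first_gf_bounds(2)[OF k _ m z] in \<open>auto simp: palindromes_def x_def\<close>)
  moreover have "(\<Sum>p\<in>palindromes m k. x / (1 + x) * (1 - (\<Sum>d\<in>{1..<m}. return_prob k p d)))
      = real k ^ ((m + 1) div 2) * (x / (1 + x))
        - x / (1 + x) * (\<Sum>p\<in>palindromes m k. \<Sum>d\<in>{1..<m}. return_prob k p d)"
    unfolding card[symmetric] by (simp add: algebra_simps sum_subtractf sum_distrib_left)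
  moreover have "(\<Sum>p\<in>palindromes m k. \<Sum>d\<in>{1..<m}. return_prob k p d) \<le> real m"
  proof -
    have "(\<Sum>p\<in>palindromes m k. \<Sum>d\<in>{1..<m}. return_prob k p d)
        = (\<Sum>d\<in>{1..<m}. real (\<Sum>p\<in>palindromes m k. card (extensions k p d)) / real k ^ d)"
      by (subst sum.swap) (simp add: return_prob_def sum_divide_distrib)
    also have "\<dots> \<le> (\<Sum>d\<in>{1..<m}. 1)"
    proof (rule sum_mono)
      fix d assume "d \<in> {1..<m}"
      then have "(\<Sum>p\<in>palindromes m k. card (extensions k p d)) \<le> k ^ d"
        by (intro sum_card_extensions_le[of d _ m]) (auto simp: palindromes_def)
      then have "real (\<Sum>p\<in>palindromes m k. card (extensions k p d)) \<le> real k ^ d"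
        unfolding of_nat_power[symmetric] of_nat_le_iff .
      then show "real (\<Sum>p\<in>palindromes m k. card (extensions k p d)) / real k ^ d \<le> 1"
        using k by (subst divide_le_eq_1_pos) auto
    qed
    finally show ?thesis
      by simp
  qed
  then have "x / (1 + x) * (\<Sum>p\<in>palindromes m k. \<Sum>d\<in>{1..<m}. return_prob k p d)
      \<le> x / (1 + x) * real m"
    using x by (intro mult_left_mono) auto
  ultimately show ?thesis
    using upper by (simp add: abs_le_iff mult.commute)
qed

text \<open>Two errors are combined: replacing \<open>x\<close> by \<open>y = 1 / (s k^m)\<close>,
  controlled by Bernoulli's inequality, and the overlap error, controlled by
  \<open>y / (1 + y) \<le> y powr (1/4)\<close>. The exponent 1/4 is positive, for summability over
  the lengths, and below 1/2, so that the error is negligible against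
  \<open>1 / sqrt s\<close>.\<close>

lemma level_gf_approx_head_term:
  assumes k: "k \<ge> 2" and s: "0 < s" "s < 1"
  shows "\<bar>level_gf k (Suc i) (1 - s) - head_term k s i\<bar>
    \<le> real (Suc i) * (1 / real k) ^ (i div 2)
      + s powr (- (1 / 4)) * (real (Suc i) * (real k powr (- (1 / 4))) ^ i)"
proof -
  define m where "m = Suc i"
  define h where "h = real k ^ Suc (i div 2)"
  define x where "x = full_gf k m (1 - s)"
  define y where "y = 1 / (s * real k ^ m)"
  have km: "real k ^ m > 0"
    using k by simp
  have y: "y > 0"
    using s km by (simp add: y_def)
  have xy: "x = (1 - s) ^ m * y"
    by (simp add: x_def y_def full_gf_def)
  have x: "0 < x" "x \<le> y"
    using s y unfolding xy by (auto intro!: mult_left_le_one_le power_le_one)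
  have phi: "x / (1 + x) \<le> y / (1 + y)"
    using x y by (simp add: field_simps)
  have "1 - real m * s \<le> (1 - s) ^ m"
    using Bernoulli_inequality[of "- s" m] s by simp
  then have yx: "y - x \<le> real m * s * y"
    using mult_right_mono[of "1 - real m * s" "(1 - s) ^ m" y] y
    by (simp add: xy algebra_simps)
  have "y / (1 + y) - x / (1 + x) = (y - x) / ((1 + x) * (1 + y))"
    using x y by (simp add: field_simps)
  also have "\<dots> \<le> (y - x) / 1"
    using x y mult_mono[of 1 "1 + x" 1 "1 + y"] by (intro divide_left_mono) auto
  also have "\<dots> \<le> real m * s * y"
    using yx by simp
  finally have phi2: "y / (1 + y) - x / (1 + x) \<le> real m * s * y" .
  have hd: "head_term k s i = h * (y / (1 + y))"
    using s km by (simp add: head_term_def h_def y_def m_def field_simps)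
  have "h * (y / (1 + y)) - h * (x / (1 + x)) \<le> h * (real m * s * y)"
    unfolding right_diff_distrib[symmetric] by (rule mult_left_mono[OF phi2]) (simp add: h_def)
  also have "\<dots> = real m * (h / real k ^ m)"
    using s by (simp add: y_def)
  also have "\<dots> \<le> real m * (1 / real k) ^ (i div 2)"
    unfolding h_def m_def using k by (intro mult_left_mono power_ratio_div2) auto
  finally have 1: "h * (y / (1 + y)) - h * (x / (1 + x)) \<le> real m * (1 / real k) ^ (i div 2)" .
  have 2: "h * (x / (1 + x)) \<le> h * (y / (1 + y))"
    by (rule mult_left_mono[OF phi]) (simp add: h_def)
  have "y / (1 + y) \<le> y powr (1 / 4)"
  proof (cases "y \<le> 1")
    case True
    have "y / (1 + y) \<le> y"
      using y by (simp add: field_simps)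
    also have "\<dots> = y powr 1"
      using y by simp
    also have "\<dots> \<le> y powr (1 / 4)"
      using y True by (intro powr_mono') auto
    finally show ?thesis .
  next
    case False
    have "y / (1 + y) \<le> 1"
      using y by simp
    also have "\<dots> \<le> y powr (1 / 4)"
      using False by (intro ge_one_powr_ge_zero) auto
    finally show ?thesis .
  qed
  also have "y powr (1 / 4) = s powr (- (1 / 4)) * (real k powr (- (1 / 4))) ^ m"
  proof -
    have "y powr (1 / 4) = (s * real k ^ m) powr (- (1 / 4))"
      using s km by (simp add: y_def powr_divide powr_minus_divide)
    also have "\<dots> = s powr (- (1 / 4)) * (real k ^ m) powr (- (1 / 4))"
      by (rule powr_mult)
    also have "(real k ^ m) powr (- (1 / 4)) = (real k powr (- (1 / 4))) ^ m"
      using k by (simp add: powr_powr powr_realpow[symmetric] mult.commute)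
    finally show ?thesis .
  qed
  also have "\<dots> \<le> s powr (- (1 / 4)) * (real k powr (- (1 / 4))) ^ i"
    using k unfolding m_def
    by (intro mult_left_mono power_decreasing) (auto simp: powr_minus_divide ge_one_powr_ge_zero)
  finally have "x / (1 + x) \<le> s powr (- (1 / 4)) * (real k powr (- (1 / 4))) ^ i"
    using phi by linarith
  then have 3: "real m * (x / (1 + x)) \<le> real m * (s powr (- (1 / 4)) * (real k powr (- (1 / 4))) ^ i)"
    by (rule mult_left_mono) simp
  have 4: "\<bar>level_gf k m (1 - s) - h * (x / (1 + x))\<bar> \<le> real m * (x / (1 + x))"
    using level_gf_approx[OF k, of m "1 - s"] s by (simp add: x_def h_def m_def)
  show ?thesis
    using 1 2 3 4 unfolding hd m_def[symmetric] by (simp add: mult_ac abs_le_iff)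
qed

section \<open>The generating function of the expected richness and its divergence argument\<close>

text \<open>Tonelli for double series: nonnegativity turns the iterated sums into one unconditional
  sum over pairs, which can be evaluated in either order.\<close>

lemma sums_swap_nonneg:
  fixes T :: "nat \<Rightarrow> nat \<Rightarrow> real"
  assumes nonneg: "\<And>i n. T i n \<ge> 0" and row: "\<And>i. T i sums g i" and tot: "g sums S"
    and col: "\<And>n. (\<lambda>i. T i n) sums h n"
  shows "h sums S"
proof -
  have g0: "g i \<ge> 0" for i
    using row[of i] nonneg by (metis sums_iff suminf_nonneg)
  have r: "((\<lambda>n. (\<lambda>(i, n). T i n) (i, n)) has_sum g i) UNIV" for i
    using sums_nonneg_imp_has_sum[OF row nonneg] by simp
  have g: "(g has_sum S) UNIV"
    by (rule sums_nonneg_imp_has_sum[OF tot g0])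
  have "(\<lambda>(i, n). T i n) summable_on UNIV \<times> UNIV"
    by (rule summable_on_SigmaI[OF r]) (use g nonneg in \<open>auto simp: summable_on_def\<close>)
  then have "((\<lambda>(i, n). T i n) has_sum S) (UNIV \<times> UNIV)"
    by (intro has_sum_SigmaI[OF r g])
  then have "((\<lambda>(n, i). T i n) has_sum S) (UNIV \<times> UNIV)"
    by (subst (asm) has_sum_swap) (simp add: case_prod_unfold)
  then have "(h has_sum S) UNIV"
    by (rule has_sum_SigmaD) (use sums_nonneg_imp_has_sum[OF col nonneg] in simp)
  then show ?thesis
    by (rule has_sum_imp_sums)
qed

text \<open>Sum the estimates for the individual lengths; \<open>C1\<close> and \<open>C2\<close> do
  not depend on \<open>s\<close>, and the sums over lengths and over \<open>n\<close> are
  exchanged.\<close>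

lemma richness_gf_approx:
  assumes k: "k \<ge> 2"
  obtains C1 C2 where "\<And>s. 0 < s \<Longrightarrow> s < 1 \<Longrightarrow>
    \<bar>s * (\<Sum>n. expected_richness n k * (1 - s) ^ n) - (\<Sum>m. head_term k s m)\<bar>
      \<le> C1 + s powr (- (1 / 4)) * C2"
proof -
  define C1 where "C1 = (\<Sum>i. real (Suc i) * (1 / real k) ^ (i div 2))"
  define C2 where "C2 = (\<Sum>i. real (Suc i) * (real k powr (- (1 / 4))) ^ i)"
  have C1: "(\<lambda>i. real (Suc i) * (1 / real k) ^ (i div 2)) sums C1"
    unfolding C1_def using k by (intro summable_sums summable_Suc_mult_power_div2) auto
  have "real k powr (- (1 / 4)) < real k powr 0"
    using k by (intro powr_less_mono) auto
  then have "norm (real k powr (- (1 / 4))) < 1"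
    using k by simp
  then have C2: "(\<lambda>i. real (Suc i) * (real k powr (- (1 / 4))) ^ i) sums C2"
    unfolding C2_def by (intro summable_sums sums_summable[OF geometric_deriv_sums])
  show ?thesis
  proof (rule that)
    fix s :: real assume s: "0 < s" "s < 1"
    then have z: "0 < 1 - s" "1 - s < 1"
      by auto
    have maj: "(\<lambda>i. real (Suc i) * (1 / real k) ^ (i div 2)
        + s powr (- (1 / 4)) * (real (Suc i) * (real k powr (- (1 / 4))) ^ i))
        sums (C1 + s powr (- (1 / 4)) * C2)"
      by (intro sums_add sums_mult C1 C2)
    have le: "norm (level_gf k (Suc i) (1 - s) - head_term k s i)
        \<le> real (Suc i) * (1 / real k) ^ (i div 2)
        + s powr (- (1 / 4)) * (real (Suc i) * (real k powr (- (1 / 4))) ^ i)" for i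
      using level_gf_approx_head_term[OF k s, of i] by simp
    have "summable (\<lambda>i. level_gf k (Suc i) (1 - s) - head_term k s i)"
      by (rule summable_comparison_test'[OF sums_summable[OF maj]]) (rule le)
    then have diff: "(\<lambda>i. level_gf k (Suc i) (1 - s) - head_term k s i)
        sums (\<Sum>i. level_gf k (Suc i) (1 - s) - head_term k s i)"
      by (rule summable_sums)
    define S where "S = (\<Sum>i. level_gf k (Suc i) (1 - s))"
    from sums_add[OF diff summable_sums[OF summable_head_term[OF k s(1)]]]
    have S: "(\<lambda>i. level_gf k (Suc i) (1 - s)) sums S"
      and dS: "(\<Sum>i. level_gf k (Suc i) (1 - s) - head_term k s i) = S - (\<Sum>m. head_term k s m)"
      by (simp_all add: S_def sums_iff)
    have "(\<lambda>n. expected_richness n k * (1 - s) ^ n) sums (S / s)"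
    proof (rule sums_swap_nonneg)
      show "level_richness k (Suc i) n * (1 - s) ^ n \<ge> 0" for i n
        using s level_richness_nonneg by simp
      show "(\<lambda>n. level_richness k (Suc i) n * (1 - s) ^ n) sums (level_gf k (Suc i) (1 - s) / s)" for i
        using level_gf_sums[OF k _ z, of "Suc i"] by simp
      show "(\<lambda>i. level_gf k (Suc i) (1 - s) / s) sums (S / s)"
        by (rule sums_divide[OF S])
      fix n
      \<comment> \<open>Palindromes longer than \<open>n\<close> contribute nothing, so the series
        over all lengths is the finite sum that makes up the expected richness.\<close>
      have "level_richness k (Suc i) n = 0" if "i \<notin> {..<n}" for i
      proof -
        have "\<not> sublist p w" if "p \<in> palindromes (Suc i) k" "w \<in> words n k" for p w
          using that \<open>i \<notin> {..<n}\<close> sublist_length_le[of p w] by (auto simp: palindromes_def words_def)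
        then show ?thesis
          unfolding level_richness_def occ_prob_def
          by (intro sum.neutral ballI) (metis (mono_tags, lifting) Collect_empty_eq card.empty div_0 of_nat_0)
      qed
      then have "(\<lambda>i. level_richness k (Suc i) n * (1 - s) ^ n)
          sums (\<Sum>i<n. level_richness k (Suc i) n * (1 - s) ^ n)"
        by (intro sums_finite) auto
      moreover have "expected_richness n k = (\<Sum>i<n. level_richness k (Suc i) n)"
        using k by (simp add: expected_richness_eq sum.atLeast1_atMost_eq)
      ultimately show "(\<lambda>i. level_richness k (Suc i) n * (1 - s) ^ n)
          sums (expected_richness n k * (1 - s) ^ n)"
        by (simp add: sum_distrib_right)
    qed
    then have "s * (\<Sum>n. expected_richness n k * (1 - s) ^ n) = S"
      using s by (simp add: sums_iff)
    then show "\<bar>s * (\<Sum>n. expected_richness n k * (1 - s) ^ n) - (\<Sum>m. head_term k s m)\<bar>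
        \<le> C1 + s powr (- (1 / 4)) * C2"
      using norm_sums_le[OF diff maj le] by (simp add: dS)
  qed
qed

text \<open>Multiplied by \<open>sqrt s\<close>, the error of \<open>richness_gf_approx\<close>
  tends to 0, so a limit \<open>c\<close> would force \<open>sqrt s\<close> times the head series to
  tend to \<open>c * Gamma (3/2)\<close>; the scaling argument then yields the excluded
  identity.\<close>

lemma not_convergent_richness:
  assumes k: "k \<ge> 2"
  shows "\<not> convergent (\<lambda>n. expected_richness n k / sqrt (real n))"
proof
  assume "convergent (\<lambda>n. expected_richness n k / sqrt (real n))"
  then obtain c where c: "(\<lambda>n. expected_richness n k / sqrt (real n)) \<longlonglongrightarrow> c"
    by (auto simp: convergent_def)
  define E where "E s = (\<Sum>n. expected_richness n k * (1 - s) ^ n)" for s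
  obtain C1 C2 where C: "\<And>s. 0 < s \<Longrightarrow> s < 1 \<Longrightarrow>
      \<bar>s * E s - (\<Sum>m. head_term k s m)\<bar> \<le> C1 + s powr (- (1 / 4)) * C2"
    using richness_gf_approx[OF k] unfolding E_def by metis
  have ev: "\<forall>\<^sub>F s in at_right (0::real). 0 < s \<and> s < 1"
    by (auto simp: eventually_at_right_field intro: exI[of _ 1])
  have "((\<lambda>s. sqrt s * (\<Sum>m. head_term k s m) - s powr (3 / 2) * E s) \<longlongrightarrow> 0) (at_right 0)"
  proof (rule Lim_null_comparison)
    show "((\<lambda>s. sqrt s * (C1 + s powr (- (1 / 4)) * C2)) \<longlongrightarrow> 0) (at_right 0)"
      by real_asymp
    show "\<forall>\<^sub>F s in at_right 0. norm (sqrt s * (\<Sum>m. head_term k s m) - s powr (3 / 2) * E s)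
        \<le> sqrt s * (C1 + s powr (- (1 / 4)) * C2)"
      using ev
    proof eventually_elim
      case (elim s)
      have "s powr (3 / 2) = s powr (1 / 2 + 1)"
        by simp
      also have "\<dots> = sqrt s * s"
        using elim unfolding powr_add by (simp add: powr_half_sqrt)
      finally have "norm (sqrt s * (\<Sum>m. head_term k s m) - s powr (3 / 2) * E s)
          = sqrt s * \<bar>s * E s - (\<Sum>m. head_term k s m)\<bar>"
        using elim abs_minus_commute[of "s * E s"]
        by (simp add: abs_mult mult.assoc flip: right_diff_distrib)
      also have "\<dots> \<le> sqrt s * (C1 + s powr (- (1 / 4)) * C2)"
        using C[of s] elim by (intro mult_left_mono) auto
      finally show ?case .
    qed
  qed
  from tendsto_add[OF this abel_sqrt[OF c]]
  have "((\<lambda>s. sqrt s * (\<Sum>m. head_term k s m)) \<longlongrightarrow> c * Gamma (3 / 2)) (at_right 0)"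
    unfolding E_def by simp
  from scaling_limit_series[OF k _ this] show False
    by (rule series_not_const_over_sqrt[OF k])
qed

subsection \<open>Limit inferior and limit superior\<close>

text \<open>The upper bound comes from the subsequence of even powers of \<open>k\<close>.\<close>

lemma lower_const_bounds:
  assumes k: "k \<ge> 2"
  shows "ereal (1 / 6) \<le> lower_const k" "lower_const k \<le> ereal 8"
proof -
  show "ereal (1 / 6) \<le> lower_const k"
    unfolding lower_const_def
  proof (rule Liminf_bounded)
    show "\<forall>\<^sub>F n in sequentially. ereal (1 / 6) \<le> ereal (expected_richness n k / sqrt (real n))"
      using eventually_gt_at_top[of 0]
      by eventually_elim (use expected_richness_lower[OF k] in \<open>simp add: field_simps\<close>)
  qed
  have mono: "strict_mono (\<lambda>A. k ^ (2 * A))"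
    by (rule strict_monoI) (use k in \<open>auto intro!: power_strict_increasing\<close>)
  have le: "expected_richness (k ^ (2 * A)) k / sqrt (real (k ^ (2 * A))) \<le> 8" for A
  proof (subst pos_divide_le_eq)
    show "0 < sqrt (real (k ^ (2 * A)))"
      using k by simp
  qed (rule expected_richness_upper_even_power[OF k])
  have "lower_const k \<le> liminf ((\<lambda>n. ereal (expected_richness n k / sqrt (real n))) \<circ> (\<lambda>A. k ^ (2 * A)))"
    unfolding lower_const_def by (rule liminf_subseq_mono[OF mono])
  also have "\<dots> \<le> liminf (\<lambda>A. ereal 8)"
    by (rule Liminf_mono) (use le in \<open>auto simp del: of_nat_power\<close>)
  finally show "lower_const k \<le> ereal 8"
    by (simp add: Liminf_const)
qed

text \<open>The lower bound comes from the subsequence of odd powers of \<open>k\<close>.\<close>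

lemma upper_const_bounds:
  assumes k: "k \<ge> 2"
  shows "ereal (sqrt (real k) / 6) \<le> upper_const k" "upper_const k \<le> ereal (8 * sqrt (real k))"
proof -
  show "upper_const k \<le> ereal (8 * sqrt (real k))"
    unfolding upper_const_def
  proof (rule Limsup_bounded)
    show "\<forall>\<^sub>F n in sequentially.
        ereal (expected_richness n k / sqrt (real n)) \<le> ereal (8 * sqrt (real k))"
      using eventually_gt_at_top[of 0]
      by eventually_elim (use expected_richness_upper[OF k] in \<open>simp add: field_simps\<close>)
  qed
  have mono: "strict_mono (\<lambda>j. k ^ Suc (2 * j))"
    by (rule strict_monoI) (use k in \<open>auto intro!: power_strict_increasing simp del: power_Suc\<close>)
  have le: "sqrt (real k) / 6 \<le> expected_richness (k ^ Suc (2 * j)) k / sqrt (real (k ^ Suc (2 * j)))" for j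
  proof (subst pos_le_divide_eq)
    show "0 < sqrt (real (k ^ Suc (2 * j)))"
      using k by simp
    show "sqrt (real k) / 6 * sqrt (real (k ^ Suc (2 * j))) \<le> expected_richness (k ^ Suc (2 * j)) k"
      using expected_richness_lower_odd_power[OF k, of j] by simp
  qed
  have "ereal (sqrt (real k) / 6) = limsup (\<lambda>j. ereal (sqrt (real k) / 6))"
    by (simp add: Limsup_const)
  also have "\<dots> \<le> limsup ((\<lambda>n. ereal (expected_richness n k / sqrt (real n))) \<circ> (\<lambda>j. k ^ Suc (2 * j)))"
    by (rule Limsup_mono) (use le in \<open>auto simp del: of_nat_power power_Suc\<close>)
  also have "\<dots> \<le> upper_const k"
    unfolding upper_const_def by (rule limsup_subseq_mono[OF mono])
  finally show "ereal (sqrt (real k) / 6) \<le> upper_const k" .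
qed

text \<open>Finite bounds exclude the infinite values, which \<open>real_of_ereal\<close> would send
  to 0.\<close>

lemma real_of_ereal_between:
  assumes "ereal a \<le> x" "x \<le> ereal b"
  shows "a \<le> real_of_ereal x" "real_of_ereal x \<le> b"
  using assms by (cases x; simp)+

theorem theorem1:
  shows "(\<forall>k\<ge>2. (\<lambda>n. expected_richness n k) \<in> \<Theta>(\<lambda>n. sqrt (real n))) \<and>
    (\<forall>k\<ge>2. \<not> convergent (\<lambda>n. expected_richness n k / sqrt (real n))) \<and>
    (\<lambda>k. real_of_ereal (lower_const k)) \<in> \<Theta>(\<lambda>k. 1) \<and>
    (\<lambda>k. real_of_ereal (upper_const k)) \<in> \<Theta>(\<lambda>k. sqrt (real k))"
proof (intro conjI allI impI)
  fix k :: nat assume k: "k \<ge> 2"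
  have E0: "0 \<le> expected_richness n k" for n
    using expected_richness_lower[OF k, of n] by (rule order_trans[rotated]) simp
  show "(\<lambda>n. expected_richness n k) \<in> \<Theta>(\<lambda>n. sqrt (real n))"
  proof (rule bigthetaI')
    show "0 < (1 / 6 :: real)" "0 < 8 * sqrt (real k)"
      using k by auto
    show "\<forall>\<^sub>F n in sequentially. 1 / 6 * norm (sqrt (real n)) \<le> norm (expected_richness n k)
        \<and> norm (expected_richness n k) \<le> 8 * sqrt (real k) * norm (sqrt (real n))"
      using expected_richness_lower[OF k] expected_richness_upper[OF k] E0 by simp
  qed
  show "\<not> convergent (\<lambda>n. expected_richness n k / sqrt (real n))"
    by (rule not_convergent_richness[OF k])
next
  have "\<forall>\<^sub>F k in sequentially. 1 / 6 * norm (1::real) \<le> norm (real_of_ereal (lower_const k))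
      \<and> norm (real_of_ereal (lower_const k)) \<le> 8 * norm (1::real)"
    using eventually_ge_at_top[of 2]
  proof eventually_elim
    case (elim k)
    define r where "r = real_of_ereal (lower_const k)"
    have "1 / 6 \<le> r" "r \<le> 8"
      using real_of_ereal_between[OF lower_const_bounds[OF elim]] by (simp_all add: r_def)
    then show ?case
      unfolding r_def[symmetric] by simp
  qed
  then show "(\<lambda>k. real_of_ereal (lower_const k)) \<in> \<Theta>(\<lambda>k. 1)"
    by (intro bigthetaI'[of "1 / 6" 8]) auto
  have "\<forall>\<^sub>F k in sequentially. 1 / 6 * norm (sqrt (real k)) \<le> norm (real_of_ereal (upper_const k))
      \<and> norm (real_of_ereal (upper_const k)) \<le> 8 * norm (sqrt (real k))"
    using eventually_ge_at_top[of 2]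
  proof eventually_elim
    case (elim k)
    define r where "r = real_of_ereal (upper_const k)"
    have "sqrt (real k) / 6 \<le> r" "r \<le> 8 * sqrt (real k)"
      using real_of_ereal_between[OF upper_const_bounds[OF elim]] by (simp_all add: r_def)
    moreover have "0 \<le> sqrt (real k)"
      by simp
    ultimately show ?case
      unfolding r_def[symmetric] by simp
  qed
  then show "(\<lambda>k. real_of_ereal (upper_const k)) \<in> \<Theta>(\<lambda>k. sqrt (real k))"
    by (intro bigthetaI'[of "1 / 6" 8]) auto
qed

end
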